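(* Let $\lambda\in(1/2,1)$ and let $\alpha<1$. Suppose that there is a sequence $\{\eta_n\}$ of numbers in $(0,1)$ such that $\lim_{n\to\infty}\eta_n=\lambda$ and $\liminf_{n\to\infty}\dim\mu_{\eta_n}\le\alpha$. Then $\dim\mu_\lambda\le\alpha$.
   Context: For $\lambda\in(0,1)$, the Bernoulli convolution $\mu_\lambda$ is the law of $\sum_{n=0}^\infty \xi_n\lambda^n$, where $\xi_0,\xi_1,\ldots$ are independent random variables with $\mathbb{P}(\xi_n=1)=\mathbb{P}(\xi_n=-1)=1/2$. It is known that $\mu_\lambda$ is exact dimensional: there is $\alpha_0\in[0,1]$ such that $\lim_{r\to0}\frac{\log\mu_\lambda(x-r,x+r)}{\log r}=\alpha_0$ for $\mu_\lambda$-almost every $x$; this number is denoted $\dim\mu_\lambda$. *)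

theory Defs
  imports "HOL-Probability.Probability"
begin

definition coin_space :: "(nat \<Rightarrow> real) measure" where
  "coin_space = (\<Pi>\<^sub>M n\<in>UNIV. measure_pmf (pmf_of_set {-1, 1}))"

(* Off a null set all coordinates are 1 or -1, so for 0 < l < 1 the series converges
   almost surely; the default value of suminf on divergent series plays no role. *)
definition bernoulli_conv :: "real \<Rightarrow> real measure" where
  "bernoulli_conv l = distr coin_space borel (\<lambda>\<xi>. \<Sum>n. \<xi> n * l ^ n)"

(* ln 0 = 0 is harmless here: almost every x lies in the support of mu, so the intervals
   have positive measure. *)
definition has_exact_dim :: "real measure \<Rightarrow> real \<Rightarrow> bool" where
  "has_exact_dim \<mu> a \<longleftrightarrow>
     (AE x in \<mu>. ((\<lambda>r. ln (measure \<mu> {x - r<..<x + r}) / ln r) \<longlongrightarrow> a) (at_right 0))"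

(* Meaningful for exact dimensional probability measures, for which the value is unique.
   Bernoulli convolutions are of this kind by a theorem, which is not built into the
   definition. *)
definition exact_dim :: "real measure \<Rightarrow> real" where
  "exact_dim \<mu> = (THE a. has_exact_dim \<mu> a)"

lemma prob_space_coin_space: "prob_space coin_space"
  unfolding coin_space_def by (intro prob_space_PiM measure_pmf.prob_space_axioms)

lemma measurable_bernoulli_sum [measurable]:
  "(\<lambda>\<xi>. \<Sum>n. \<xi> n * l ^ n) \<in> borel_measurable coin_space"
proof -
  have "(\<lambda>\<xi>. \<xi> n) \<in> borel_measurable coin_space" for n
    unfolding coin_space_def
    by (rule measurable_compose[OF measurable_component_singleton]) simp_all
  then show ?thesis
    by (intro borel_measurable_suminf borel_measurable_times) auto
qed

lemma AE_coin_space: "AE \<xi> in coin_space. \<forall>n. \<xi> n \<in> {-1, 1}"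
proof -
  have "AE \<xi> in coin_space. \<xi> n \<in> {-1, 1}" for n
    unfolding coin_space_def
    by (rule AE_PiM_component)
       (auto intro: measure_pmf.prob_space_axioms simp: AE_measure_pmf_iff)
  then show ?thesis
    by (simp add: AE_all_countable)
qed

lemma prob_space_bernoulli_conv: "prob_space (bernoulli_conv l)"
  unfolding bernoulli_conv_def
  by (intro prob_space.prob_space_distr prob_space_coin_space measurable_bernoulli_sum)

lemma has_exact_dim_unique:
  assumes "prob_space \<mu>" "has_exact_dim \<mu> a" "has_exact_dim \<mu> b"
  shows "a = b"
proof -
  interpret prob_space \<mu> by fact
  have "AE x in \<mu>. a = b"
    using assms(2,3) unfolding has_exact_dim_def
    by eventually_elim (rule tendsto_unique[OF trivial_limit_at_right_real])
  then show ?thesis by simp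
qed

lemma exact_dim_eqI:
  assumes "prob_space \<mu>" "has_exact_dim \<mu> a"
  shows "exact_dim \<mu> = a"
  unfolding exact_dim_def using assms has_exact_dim_unique by blast

end

(* Write X for the random series with ratio l and mu for its law. If B(x, r) is a centred interval,
   then, by self-similarity, the joint probability of B(X, l^n) and of the first coin is half the
   measure of an interval of radius l^(n-1) around the series of the shifted coins. Iterating this,
   - ln mu(B(X, l^n)) equals n ln 2 plus a sum over the orbit of the shift of logarithms of
   conditional probabilities of the first coin at finite scales. These converge by a
   differentiation theorem, with an integrable majorant by a maximal inequality, so Maker's ergodic
   theorem gives that mu is exact dimensional with

     dim mu = (ln 2 - H(xi_0 | X)) / (- ln l).

   By Gibbs' inequality the conditional entropy H(xi_0 | X) is the infimum of the cross entropies
   of xi_0 relative to continuous functions of X, each of which depends continuously on l. Hence it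
   is upper semicontinuous in l, and the dimension is lower semicontinuous. *)

theory Submission
  imports Defs
begin

section \<open>Centred intervals on the line\<close>

text \<open>The law of the series can be singular and need not be doubling, so the differentiation
  theorem and the maximal inequality are needed for arbitrary finite measures; both rest on a
  covering fact special to the line. Logarithms are unbounded where a conditional probability is
  small. The maximal inequality handles this with the roles of the measures exchanged: the event
  that at some scale the first coin actually seen has conditional probability at most t has
  probability at most 4 t, and t = exp (- k) makes the largest absolute logarithm integrable. In the
  orbit sum the k-th term is taken at scale n - k, so the summands vary with n; this is why
  Birkhoff's theorem does not suffice and Maker's is used. In the last part, laws with different
  ratios can be mutually singular, so their conditional probabilities are hard to compare. A
  continuous test function with values bounded away from 0 and 1 avoids the comparison: a fixed one
  gives a lower bound for every dimension, by an expression that is continuous in the ratio.\<close>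

lemma three_intervals_redundant:
  fixes a b :: "'i \<Rightarrow> real"
  assumes "finite S" "card S > 2" "\<And>i. i \<in> S \<Longrightarrow> a i < x \<and> x < b i"
  obtains k where "k \<in> S" "{a k<..<b k} \<subseteq> (\<Union>i\<in>S - {k}. {a i<..<b i})"
proof -
  have "S \<noteq> {}" using assms(2) by auto
  \<comment> \<open>All intervals contain \<open>x\<close>, so the one reaching furthest left and
    the one reaching furthest right together cover the union; any third one can go.\<close>
  then obtain i where i: "i \<in> S" "\<And>k. k \<in> S \<Longrightarrow> a i \<le> a k"
    using ex_min_if_finite[of "a ` S"] assms(1) by (metis arg_min_if_finite(1) arg_min_least)
  obtain j where j: "j \<in> S" "\<And>k. k \<in> S \<Longrightarrow> b k \<le> b j"
    using obtains_MAX[OF assms(1) \<open>S \<noteq> {}\<close>, of b] Max_ge[of "b ` S"] assms(1) by (metis finite_imageI image_eqI)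
  have "\<not> S \<subseteq> {i, j}"
  proof
    assume "S \<subseteq> {i, j}"
    then have "card S \<le> card {i, j}" by (intro card_mono) auto
    also have "\<dots> \<le> 2" by (simp add: card_insert_le_m1)
    finally show False using assms(2) by simp
  qed
  then obtain k where k: "k \<in> S" "k \<noteq> i" "k \<noteq> j" by auto
  have "y \<in> {a i<..<b i} \<or> y \<in> {a j<..<b j}" if "y \<in> {a k<..<b k}" for y
    using that assms(3)[OF i(1)] assms(3)[OF j(1)] i(2)[OF k(1)] j(2)[OF k(1)]
    unfolding greaterThanLessThan_iff by linarith
  then have "{a k<..<b k} \<subseteq> (\<Union>i\<in>S - {k}. {a i<..<b i})"
    using i(1) j(1) k by blast
  then show thesis using that k(1) by blast
qed

text \<open>At a point of triple overlap some interval is covered by the others. Dropping it keeps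
  the union and shrinks the finite family, so this stops.\<close>

lemma interval_subcover_overlap:
  fixes a b :: "'i \<Rightarrow> real"
  assumes "finite F"
  shows "\<exists>G\<subseteq>F. (\<Union>i\<in>G. {a i<..<b i}) = (\<Union>i\<in>F. {a i<..<b i})
    \<and> (\<forall>x. card {i\<in>G. x \<in> {a i<..<b i}} \<le> 2)"
  using assms
proof (induction rule: finite_psubset_induct)
  case (psubset F)
  show ?case
  proof (cases "\<forall>x. card {i\<in>F. x \<in> {a i<..<b i}} \<le> 2")
    case True
    then show ?thesis by blast
  next
    case False
    then obtain x where x: "card {i\<in>F. x \<in> {a i<..<b i}} > 2"
      by (auto simp: not_le)
    let ?S = "{i\<in>F. x \<in> {a i<..<b i}}"
    obtain k where k: "k \<in> ?S" "{a k<..<b k} \<subseteq> (\<Union>i\<in>?S - {k}. {a i<..<b i})"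
      by (rule three_intervals_redundant[of ?S a x b]) (use x psubset.hyps in auto)
    then obtain G where G: "G \<subseteq> F - {k}"
      "(\<Union>i\<in>G. {a i<..<b i}) = (\<Union>i\<in>F - {k}. {a i<..<b i})"
      "\<forall>x. card {i\<in>G. x \<in> {a i<..<b i}} \<le> 2"
      using psubset.IH[of "F - {k}"] by blast
    have "(\<Union>i\<in>F - {k}. {a i<..<b i}) = (\<Union>i\<in>F. {a i<..<b i})"
      using k by fastforce
    with G show ?thesis by (intro exI[of _ G]) auto
  qed
qed

text \<open>A maximal inequality of weak type for centred intervals. On the line every finite family of
  intervals has a subfamily with the same union that covers no point more than twice, so no
  doubling condition on the measures is needed.\<close>

lemma emeasure_le_of_centred_intervals:
  fixes \<alpha> \<beta> :: "real measure"
  assumes "finite_measure \<alpha>" and sets [measurable_cong]: "sets \<alpha> = sets borel" "sets \<beta> = sets borel"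
    and A: "A \<in> sets borel"
    and le: "\<And>x. x \<in> A \<Longrightarrow> \<exists>r>0. emeasure \<alpha> {x - r<..<x + r} \<le> emeasure \<beta> {x - r<..<x + r}"
  shows "emeasure \<alpha> A \<le> 2 * emeasure \<beta> UNIV"
proof -
  interpret finite_measure \<alpha> by fact
  have sp: "space \<beta> = UNIV" using sets_eq_imp_space_eq[OF sets(2)] by simp
  obtain r where r: "\<And>x. x \<in> A \<Longrightarrow> r x > 0"
    "\<And>x. x \<in> A \<Longrightarrow> emeasure \<alpha> {x - r x<..<x + r x} \<le> emeasure \<beta> {x - r x<..<x + r x}"
    using le by metis
  \<comment> \<open>Inner regularity reduces the claim to compact subsets, for which compactness
    supplies the finite family that the covering lemma needs.\<close>
  have "emeasure \<alpha> K \<le> 2 * emeasure \<beta> UNIV" if K: "K \<subseteq> A" "compact K" for K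
  proof -
    let ?I = "\<lambda>x. {x - r x<..<x + r x}"
    obtain F where F: "F \<subseteq> K" "finite F" "K \<subseteq> (\<Union>x\<in>F. ?I x)"
    proof (rule compactE_image[OF K(2), of K ?I])
      show "K \<subseteq> (\<Union>c\<in>K. ?I c)" using r(1) K(1) by fastforce
    qed auto
    obtain G where G: "G \<subseteq> F" "(\<Union>x\<in>G. ?I x) = (\<Union>x\<in>F. ?I x)" "\<And>y. card {x\<in>G. y \<in> ?I x} \<le> 2"
      using interval_subcover_overlap[OF F(2), of "\<lambda>x. x - r x" "\<lambda>x. x + r x"] by blast
    have fin: "finite G" using G(1) F(2) finite_subset by blast
    have "emeasure \<alpha> K \<le> emeasure \<alpha> (\<Union>x\<in>G. ?I x)"
      using F(3) G(2) fin by (intro emeasure_mono sets.finite_UN) auto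
    also have "\<dots> \<le> (\<Sum>x\<in>G. emeasure \<alpha> (?I x))"
      using fin by (intro emeasure_subadditive_finite) auto
    also have "\<dots> \<le> (\<Sum>x\<in>G. emeasure \<beta> (?I x))"
      using r(2) G(1) F(1) K(1) by (intro sum_mono) blast
    also have "\<dots> = (\<integral>\<^sup>+y. (\<Sum>x\<in>G. indicator (?I x) y) \<partial>\<beta>)"
      by (subst nn_integral_sum) auto
    also have "\<dots> \<le> (\<integral>\<^sup>+y. 2 \<partial>\<beta>)"
    proof (rule nn_integral_mono)
      fix y
      have "(\<Sum>x\<in>G. indicator (?I x) y) = (of_nat (card {x\<in>G. y \<in> ?I x}) :: ennreal)"
        using fin by (simp add: indicator_def sum.If_cases Int_def)
      also have "\<dots> \<le> of_nat 2" using G(3)[of y] of_nat_mono by blast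
      finally show "(\<Sum>x\<in>G. indicator (?I x) y) \<le> (2 :: ennreal)" by simp
    qed
    also have "\<dots> = 2 * emeasure \<beta> UNIV" by (simp add: sp)
    finally show ?thesis .
  qed
  moreover have "emeasure \<alpha> A = (SUP K \<in> {K. K \<subseteq> A \<and> compact K}. emeasure \<alpha> K)"
    by (rule inner_regular[OF sets(1) _ A]) simp
  ultimately show ?thesis by (auto intro!: SUP_least)
qed

section \<open>Approximation in L1 by continuous functions\<close>

lemma tendsto_ex_less:
  fixes X :: "nat \<Rightarrow> real"
  assumes "X \<longlonglongrightarrow> L" "L < e"
  shows "\<exists>n. X n < e"
  using eventually_happens'[OF sequentially_bot order_tendstoD(2)[OF assms]] .

text \<open>Inner regularity gives a compact \<open>K\<close> inside \<open>A\<close> of nearly the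
  same measure, and tent functions over \<open>K\<close> decrease to its indicator under the bound
  1.\<close>

lemma indicator_L1_continuous:
  fixes M :: "real measure"
  assumes "finite_measure M" and sets [measurable_cong]: "sets M = sets borel"
    and A: "A \<in> sets borel" and "e > 0"
  shows "\<exists>g. continuous_on UNIV g \<and> (\<forall>x. 0 \<le> g x \<and> g x \<le> 1) \<and> (\<integral>x. \<bar>indicat_real A x - g x\<bar> \<partial>M) < (e::real)"
proof -
  interpret finite_measure M by fact
  have [measurable]: "A \<in> sets M" using A sets by simp
  have "\<exists>K\<subseteq>A. compact K \<and> measure M A - e / 2 < measure M K"
  \<comment> \<open>Subtraction in \<open>ennreal\<close> stops at 0, so
    \<open>emeasure M A - e / 2\<close> is strictly below \<open>emeasure M A\<close> only if the
    latter is positive.\<close>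
  proof (cases "emeasure M A = 0")
    case True
    then have "measure M A - e / 2 < measure M {}" using \<open>e > 0\<close> by (simp add: measure_def)
    then show ?thesis by (intro exI[of _ "{}"]) simp
  next
    case False
    have "0 < emeasure M A" using False by (simp add: zero_less_iff_neq_zero)
    moreover have "0 < ennreal (e / 2)" using \<open>e > 0\<close> by simp
    ultimately have "emeasure M A - ennreal (e / 2) < emeasure M A"
      by (intro ennreal_between) (simp_all add: emeasure_eq_measure)
    moreover have "emeasure M A = (SUP K \<in> {K. K \<subseteq> A \<and> compact K}. emeasure M K)"
      by (rule inner_regular[OF sets _ A]) simp
    ultimately obtain K where "K \<subseteq> A" "compact K" "emeasure M A - ennreal (e / 2) < emeasure M K"
      by (auto simp: less_SUP_iff)
    moreover have "measure M A - e / 2 < measure M K"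
    proof -
      have "ennreal (measure M A - e / 2) < ennreal (measure M K)"
        using \<open>emeasure M A - ennreal (e / 2) < emeasure M K\<close> \<open>e > 0\<close>
        by (simp add: emeasure_eq_measure ennreal_minus)
      then show ?thesis by (meson ennreal_leI not_le)
    qed
    ultimately show ?thesis by blast
  qed
  then obtain K where K: "K \<subseteq> A" "compact K" "measure M A - e / 2 < measure M K" by blast
  have [measurable]: "K \<in> sets M" using K(2) sets borel_compact by auto
  \<comment> \<open>Tents of slope n over \<open>K\<close>. The empty set is separate because
    \<open>infdist x {}\<close> is 0, which would turn the tent into the constant 1.\<close>
  define g where "g = (\<lambda>n x. if K = {} then 0 else max 0 (1 - real n * infdist x K))"
  have g01: "0 \<le> g n x \<and> g n x \<le> 1" for n x
    using infdist_nonneg[of x K] by (auto simp: g_def)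
  have cont: "continuous_on UNIV (g n)" for n
    unfolding g_def by (cases "K = {}") (auto intro!: continuous_intros)
  have [measurable]: "g n \<in> borel_measurable M" for n
    using borel_measurable_continuous_onI[OF cont] measurable_cong_sets[OF sets refl] by blast
  have lim: "(\<lambda>n. g n x) \<longlonglongrightarrow> indicat_real K x" for x
  proof (cases "x \<in> K")
    case True
    then have "g n x = 1" for n by (auto simp: g_def)
    then show ?thesis using True by simp
  next
    case False
    show ?thesis
    proof (cases "K = {}")
      case True then show ?thesis by (simp add: g_def)
    next
      case ne: False
      then have pos: "infdist x K > 0"
        using False K(2) ne infdist_pos_not_in_closed compact_imp_closed by blast
      have "eventually (\<lambda>n. real n > 1 / infdist x K) sequentially"
        using filterlim_real_sequentially by (auto simp: filterlim_at_top_dense)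
      then have "eventually (\<lambda>n. g n x = indicat_real K x) sequentially"
        by eventually_elim (use pos False ne in \<open>auto simp: g_def field_simps\<close>)
      then show ?thesis by (rule tendsto_eventually)
    qed
  qed
  have "(\<lambda>n. \<integral>x. \<bar>indicat_real A x - g n x\<bar> \<partial>M) \<longlonglongrightarrow> (\<integral>x. \<bar>indicat_real A x - indicat_real K x\<bar> \<partial>M)"
  proof (intro integral_dominated_convergence[where w="\<lambda>_. 1"])
    show "AE x in M. (\<lambda>n. \<bar>indicat_real A x - g n x\<bar>) \<longlonglongrightarrow> \<bar>indicat_real A x - indicat_real K x\<bar>"
      by (intro AE_I2 tendsto_intros lim)
    show "AE x in M. norm \<bar>indicat_real A x - g n x\<bar> \<le> 1" for n
      using g01 by (intro AE_I2) (auto simp: indicator_def)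
  qed auto
  moreover have "(\<integral>x. \<bar>indicat_real A x - indicat_real K x\<bar> \<partial>M) < e"
  proof -
    have "(\<integral>x. \<bar>indicat_real A x - indicat_real K x\<bar> \<partial>M) = (\<integral>x. indicat_real (A - K) x \<partial>M)"
      using K(1) by (intro Bochner_Integration.integral_cong) (auto simp: indicator_def)
    also have "\<dots> = measure M A - measure M K"
      using K(1) by (simp add: finite_measure_Diff)
    also have "\<dots> < e" using K(3) \<open>e > 0\<close> by simp
    finally show ?thesis .
  qed
  ultimately obtain n where "(\<integral>x. \<bar>indicat_real A x - g n x\<bar> \<partial>M) < e"
    using tendsto_ex_less by meson
  with cont g01 show ?thesis by (intro exI[of _ "g n"]) simp
qed

lemma L1_approx_bounded_continuous:
  fixes M :: "real measure" and f :: "real \<Rightarrow> real"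
  assumes "finite_measure M" and sets [measurable_cong]: "sets M = sets borel"
    and "integrable M f"
  shows "\<forall>e>0. \<exists>g. continuous_on UNIV g \<and> integrable M g \<and> (\<integral>x. \<bar>f x - g x\<bar> \<partial>M) < e"
  using assms(3)
proof (induction rule: integrable_induct)
  case (base A c)
  interpret finite_measure M by fact
  show ?case
  proof safe
    fix e :: real assume "e > 0"
    \<comment> \<open>The denominator \<open>\<bar>c\<bar> + 1\<close> also covers
      \<open>c = 0\<close>.\<close>
    then obtain g where g: "continuous_on UNIV g" "\<And>x. 0 \<le> g x \<and> g x \<le> 1"
      "(\<integral>x. \<bar>indicat_real A x - g x\<bar> \<partial>M) < e / (\<bar>c\<bar> + 1)"
      using indicator_L1_continuous[of M A "e / (\<bar>c\<bar> + 1)"] base assms(1) sets by auto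
    have [measurable]: "g \<in> borel_measurable M"
      using borel_measurable_continuous_onI[OF g(1)] measurable_cong_sets[OF sets refl] by blast
    have int: "integrable M g"
      using g(2) by (intro integrable_const_bound[where B=1]) auto
    have "(\<integral>x. \<bar>indicator A x *\<^sub>R c - c * g x\<bar> \<partial>M) = (\<integral>x. \<bar>c\<bar> * \<bar>indicat_real A x - g x\<bar> \<partial>M)"
      by (intro Bochner_Integration.integral_cong) (auto simp: abs_mult[symmetric] algebra_simps)
    also have "\<dots> \<le> \<bar>c\<bar> * (e / (\<bar>c\<bar> + 1))"
      using g(3) by (simp del: times_divide_eq_right add: mult_left_mono)
    also have "\<dots> < e" using \<open>e > 0\<close> by (simp add: field_simps)
    finally show "\<exists>g. continuous_on UNIV g \<and> integrable M g \<and> (\<integral>x. \<bar>indicator A x *\<^sub>R c - g x\<bar> \<partial>M) < e"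
      using g(1) int by (intro exI[of _ "\<lambda>x. c * g x"]) (auto intro!: continuous_intros)
  qed
next
  case (add f1 f2)
  show ?case
  proof safe
    fix e :: real assume "e > 0"
    then have "e / 2 > 0" by simp
    then obtain g1 g2 where g: "continuous_on UNIV g1" "integrable M g1" "(\<integral>x. \<bar>f1 x - g1 x\<bar> \<partial>M) < e / 2"
      "continuous_on UNIV g2" "integrable M g2" "(\<integral>x. \<bar>f2 x - g2 x\<bar> \<partial>M) < e / 2"
      using add(3,4) by blast
    have "(\<integral>x. \<bar>(f1 x + f2 x) - (g1 x + g2 x)\<bar> \<partial>M) \<le> (\<integral>x. \<bar>f1 x - g1 x\<bar> + \<bar>f2 x - g2 x\<bar> \<partial>M)"
      using add(1,2) g by (intro integral_mono) auto
    also have "\<dots> < e" using add(1,2) g by (subst Bochner_Integration.integral_add) auto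
    finally show "\<exists>g. continuous_on UNIV g \<and> integrable M g \<and> (\<integral>x. \<bar>(f1 x + f2 x) - g x\<bar> \<partial>M) < e"
      using g by (intro exI[of _ "\<lambda>x. g1 x + g2 x"]) (auto intro!: continuous_intros)
  qed
next
  case (lim f s)
  show ?case
  proof safe
    fix e :: real assume "e > 0"
    have [measurable]: "f \<in> borel_measurable M" "\<And>i. s i \<in> borel_measurable M"
      using lim by auto
    have "(\<lambda>i. \<integral>x. \<bar>f x - s i x\<bar> \<partial>M) \<longlonglongrightarrow> (\<integral>x. 0 \<partial>M)"
    proof (intro integral_dominated_convergence[where w="\<lambda>x. \<bar>f x\<bar> + 2 * \<bar>f x\<bar>"])
      show "AE x in M. (\<lambda>i. \<bar>f x - s i x\<bar>) \<longlonglongrightarrow> 0"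
      proof (rule AE_I2)
        fix x assume "x \<in> space M"
        then have "(\<lambda>i. \<bar>f x - s i x\<bar>) \<longlonglongrightarrow> \<bar>f x - f x\<bar>"
          using lim by (intro tendsto_intros) auto
        then show "(\<lambda>i. \<bar>f x - s i x\<bar>) \<longlonglongrightarrow> 0" by simp
      qed
    next
      show "AE x in M. norm \<bar>f x - s i x\<bar> \<le> \<bar>f x\<bar> + 2 * \<bar>f x\<bar>" for i
      proof (rule AE_I2)
        fix x assume "x \<in> space M"
        then have "norm (s i x) \<le> 2 * norm (f x)" using lim(3) by blast
        then show "norm \<bar>f x - s i x\<bar> \<le> \<bar>f x\<bar> + 2 * \<bar>f x\<bar>" by simp
      qed
    qed (use lim in auto)
    then obtain i where i: "(\<integral>x. \<bar>f x - s i x\<bar> \<partial>M) < e / 2"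
      using tendsto_ex_less[of _ _ "e / 2"] \<open>e > 0\<close> by fastforce
    obtain g where g: "continuous_on UNIV g" "integrable M g" "(\<integral>x. \<bar>s i x - g x\<bar> \<partial>M) < e / 2"
      using lim(5)[of i] \<open>e > 0\<close> half_gt_zero by blast
    have "(\<integral>x. \<bar>f x - g x\<bar> \<partial>M) \<le> (\<integral>x. \<bar>f x - s i x\<bar> + \<bar>s i x - g x\<bar> \<partial>M)"
      using lim(1,4) g by (intro integral_mono) auto
    also have "\<dots> < e" using lim(1,4) g i by (subst Bochner_Integration.integral_add) auto
    finally show "\<exists>g. continuous_on UNIV g \<and> integrable M g \<and> (\<integral>x. \<bar>f x - g x\<bar> \<partial>M) < e"
      using g by blast
  qed
qed

text \<open>Truncation to the unit interval is 1-Lipschitz and fixes the values of \<open>f\<close>,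
  so it does not increase the L1 distance. A conditional probability can thus be approximated by
  functions that are themselves probabilities.\<close>

lemma L1_approx_unit_continuous:
  fixes M :: "real measure" and f :: "real \<Rightarrow> real"
  assumes "finite_measure M" and sets [measurable_cong]: "sets M = sets borel"
    and [measurable]: "f \<in> borel_measurable borel" and f01: "\<And>x. 0 \<le> f x \<and> f x \<le> 1" and "e > 0"
  obtains g where "continuous_on UNIV g" "\<And>x. 0 \<le> g x \<and> g x \<le> 1" "(\<integral>x. \<bar>f x - g x\<bar> \<partial>M) < e"
proof -
  interpret finite_measure M by fact
  have int: "integrable M f"
    using f01 by (intro integrable_const_bound[where B=1]) auto
  then obtain g where g: "continuous_on UNIV g" "integrable M g" "(\<integral>x. \<bar>f x - g x\<bar> \<partial>M) < e"
    using L1_approx_bounded_continuous[OF assms(1) sets int] \<open>e > 0\<close> by blast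
  have [measurable]: "g \<in> borel_measurable borel" using g(1) by (rule borel_measurable_continuous_onI)
  have "(\<integral>x. \<bar>f x - max 0 (min 1 (g x))\<bar> \<partial>M) \<le> (\<integral>x. \<bar>f x - g x\<bar> \<partial>M)"
  proof (rule integral_mono)
    have "integrable M (\<lambda>x. max 0 (min 1 (g x)))"
      by (intro integrable_const_bound[where B=1]) auto
    then show "integrable M (\<lambda>x. \<bar>f x - max 0 (min 1 (g x))\<bar>)" using int by auto
    show "\<bar>f x - max 0 (min 1 (g x))\<bar> \<le> \<bar>f x - g x\<bar>" for x
      using f01[of x] by (auto simp: max_def min_def)
  qed (use int g in auto)
  then show thesis
    using g by (intro that[of "\<lambda>x. max 0 (min 1 (g x))"]) (auto intro!: continuous_on_max continuous_on_min continuous_on_const)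
qed

section \<open>Ergodic theorems\<close>

locale ergodic_map = prob_space M for M :: "'a measure" +
  fixes T :: "'a \<Rightarrow> 'a"
  assumes measurable_map [measurable]: "T \<in> measurable M M"
    and distr_map: "distr M M T = M"
    and invariant_trivial:
      "\<And>A. A \<in> sets M \<Longrightarrow> T -` A \<inter> space M = A \<Longrightarrow> prob A = 0 \<or> prob A = 1"
begin

lemma integral_map: "f \<in> borel_measurable M \<Longrightarrow> (\<integral>x. f (T x) \<partial>M) = (\<integral>x. f x \<partial>M)"
  for f :: "'a \<Rightarrow> real"
  using integral_distr[OF measurable_map, of f] by (simp add: distr_map)

lemma integrable_map: "integrable M f \<Longrightarrow> integrable M (\<lambda>x. f (T x))"
  for f :: "'a \<Rightarrow> real"
  using integrable_distr[OF measurable_map, of f] by (simp add: distr_map)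

lemma AE_map:
  assumes "AE x in M. P x"
  shows "AE x in M. P (T x)"
  by (rule AE_distrD[OF measurable_map, unfolded distr_map, OF assms])

lemma AE_funpow:
  assumes "AE x in M. P x"
  shows "AE x in M. \<forall>k. P ((T ^^ k) x)"
proof -
  have "AE x in M. P ((T ^^ k) x)" for k
  proof (induction k)
    case (Suc k)
    then show ?case using AE_map[of "\<lambda>x. P ((T ^^ k) x)"] by (simp add: funpow_swap1)
  qed (use assms in simp)
  then show ?thesis by (simp add: AE_all_countable)
qed

text \<open>Written recursively, \<open>run_max f n\<close> is the maximum of the first \<open>n + 1\<close> nonempty Birkhoff sums.\<close>

primrec run_max :: "('a \<Rightarrow> real) \<Rightarrow> nat \<Rightarrow> 'a \<Rightarrow> real" where
  "run_max f 0 = f"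
| "run_max f (Suc n) = (\<lambda>x. f x + max 0 (run_max f n (T x)))"

lemma integrable_run_max: "integrable M f \<Longrightarrow> integrable M (run_max f n)"
  by (induction n) (auto intro!: Bochner_Integration.integrable_add integrable_max integrable_map)

lemma run_max_le_Suc: "run_max f n x \<le> run_max f (Suc n) x"
proof (induction n arbitrary: x)
  case (Suc n)
  show ?case using Suc[of "T x"] by (simp add: max.coboundedI2)
qed simp

lemma run_max_mono: "m \<le> n \<Longrightarrow> run_max f m x \<le> run_max f n x"
  using lift_Suc_mono_le[of "\<lambda>n. run_max f n x"] run_max_le_Suc by blast

lemma sum_le_run_max: "(\<Sum>k<Suc n. f ((T ^^ k) x)) \<le> run_max f n x"
proof (induction n arbitrary: x)
  case (Suc n)
  have "(\<Sum>k<Suc (Suc n). f ((T ^^ k) x)) = f x + (\<Sum>k<Suc n. f ((T ^^ k) (T x)))"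
    by (subst sum.lessThan_Suc_shift) (simp add: funpow_swap1)
  also have "\<dots> \<le> f x + run_max f n (T x)" using Suc[of "T x"] by simp
  also have "\<dots> \<le> run_max f (Suc n) x" by simp
  finally show ?case .
qed simp

text \<open>Garsia's argument: where \<open>run_max f\<close> is unbounded, the differences
  \<open>run_max f (Suc n) - run_max f n \<circ> T\<close> are eventually equal to \<open>f\<close>, and their integrals are
  nonnegative because \<open>T\<close> preserves the measure. As this invariant set is trivial, it is null when \<open>f\<close> has
  negative integral.\<close>

lemma AE_run_max_bounded:
  assumes f: "integrable M f" and neg: "(\<integral>x. f x \<partial>M) < 0"
  shows "AE x in M. \<exists>C. \<forall>n. run_max f n x \<le> C"
proof -
  have [measurable]: "f \<in> borel_measurable M" "\<And>n. run_max f n \<in> borel_measurable M"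
    using f integrable_run_max[OF f] by auto
  define A where "A = {x \<in> space M. \<forall>C::nat. \<exists>n. real C < run_max f n x}"
  have [measurable]: "A \<in> sets M" unfolding A_def by measurable
  have Tsp: "T x \<in> space M" if "x \<in> space M" for x
    using that measurable_space[OF measurable_map] by blast
  \<comment> \<open>The recursion relates the maxima at \<open>x\<close> and at \<open>T x\<close>
    through the finite value \<open>f x\<close>, which cannot change whether they are
    unbounded.\<close>
  have "x \<in> A \<longleftrightarrow> T x \<in> A" if x: "x \<in> space M" for x
  proof
    assume "x \<in> A"
    have "\<exists>n. real C < run_max f n (T x)" for C
    proof -
      obtain C' :: nat where C': "f x + real C < real C'" using reals_Archimedean2 by blast
      obtain n where "real C' < run_max f n x" using \<open>x \<in> A\<close> by (auto simp: A_def)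
      then have "real C' < run_max f (Suc n) x" using run_max_le_Suc[of f n x] by linarith
      then have "real C < run_max f n (T x)" using C' by auto
      then show ?thesis by blast
    qed
    then show "T x \<in> A" using Tsp[OF x] by (simp add: A_def)
  next
    assume "T x \<in> A"
    have "\<exists>n. real C < run_max f n x" for C
    proof -
      obtain C' :: nat where C': "real C - f x < real C'" using reals_Archimedean2 by blast
      obtain n where "real C' < run_max f n (T x)" using \<open>T x \<in> A\<close> by (auto simp: A_def)
      then have "real C < run_max f (Suc n) x" using C' by auto
      then show ?thesis by blast
    qed
    then show "x \<in> A" using x by (simp add: A_def)
  qed
  then have "T -` A \<inter> space M = A" by (auto simp: A_def)
  then have "prob A = 0 \<or> prob A = 1" using invariant_trivial by simp
  moreover have "prob A \<noteq> 1"
  proof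
    assume "prob A = 1"
    then have AE: "AE x in M. x \<in> A" by (simp add: prob_eq_1)
    let ?d = "\<lambda>n x. run_max f (Suc n) x - run_max f n (T x)"
    have "0 \<le> (\<integral>x. ?d n x \<partial>M)" for n
    proof -
      have "(\<integral>x. ?d n x \<partial>M) = (\<integral>x. run_max f (Suc n) x \<partial>M) - (\<integral>x. run_max f n (T x) \<partial>M)"
        using integrable_run_max[OF f] integrable_map
        by (intro Bochner_Integration.integral_diff) blast+
      also have "(\<integral>x. run_max f n (T x) \<partial>M) = (\<integral>x. run_max f n x \<partial>M)"
        by (rule integral_map) measurable
      also have "(\<integral>x. run_max f (Suc n) x \<partial>M) - (\<integral>x. run_max f n x \<partial>M) \<ge> 0"
        using integral_mono[OF integrable_run_max[OF f, of n] integrable_run_max[OF f, of "Suc n"] run_max_le_Suc]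
        by simp
      finally show ?thesis .
    qed
    moreover have "(\<lambda>n. \<integral>x. ?d n x \<partial>M) \<longlonglongrightarrow> (\<integral>x. f x \<partial>M)"
    proof (intro integral_dominated_convergence[where w="\<lambda>x. \<bar>f x\<bar> + \<bar>f (T x)\<bar>"])
      show "integrable M (\<lambda>x. \<bar>f x\<bar> + \<bar>f (T x)\<bar>)" using f integrable_map[OF f] by auto
      show "AE x in M. (\<lambda>n. ?d n x) \<longlonglongrightarrow> f x"
        using AE_map[OF AE]
      proof eventually_elim
        case (elim x)
        then obtain m where m: "0 < run_max f m (T x)" by (auto simp: A_def) (metis of_nat_0)
        have "?d n x = f x" if "n \<ge> m" for n
          using run_max_mono[OF that, of f "T x"] m by auto
        then show ?case by (intro tendsto_eventually) (auto simp: eventually_sequentially)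
      qed
      \<comment> \<open>The difference is \<open>f x\<close> plus the negative part of
        \<open>run_max f n (T x)\<close>, and that maximum is at least its first entry
        \<open>f (T x)\<close>.\<close>
      show "AE x in M. norm (?d n x) \<le> \<bar>f x\<bar> + \<bar>f (T x)\<bar>" for n
      proof (rule AE_I2)
        fix x
        show "norm (?d n x) \<le> \<bar>f x\<bar> + \<bar>f (T x)\<bar>"
          using run_max_mono[of 0 n f "T x"] by (auto simp: max_def)
      qed
    qed measurable
    ultimately have "0 \<le> (\<integral>x. f x \<partial>M)" by (intro LIMSEQ_le_const) auto
    then show False using neg by simp
  qed
  ultimately have "prob A = 0" by simp
  then have "AE x in M. x \<notin> A" by (simp add: AE_iff_measurable[OF _ refl] prob_eq_0)
  then show ?thesis
    using AE_space by eventually_elim (auto simp: A_def not_less)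
qed

text \<open>Subtracting \<open>c\<close> makes the integral negative, and bounded maxima then bound
  all Birkhoff sums of \<open>f - c\<close> from above.\<close>

lemma AE_birkhoff_sum_le:
  assumes f: "integrable M f" and c: "(\<integral>x. f x \<partial>M) < c"
  shows "AE x in M. \<exists>C. \<forall>n. (\<Sum>k<n. f ((T ^^ k) x)) \<le> C + c * real n"
proof -
  have "AE x in M. \<exists>C. \<forall>n. run_max (\<lambda>x. f x - c) n x \<le> C"
    using f c by (intro AE_run_max_bounded) (auto simp: prob_space)
  then show ?thesis
  proof eventually_elim
    case (elim x)
    then obtain C where C: "\<And>n. run_max (\<lambda>x. f x - c) n x \<le> C" by blast
    \<comment> \<open>The empty sum is not among the sums that \<open>run_max\<close> controls; the
      absolute value covers it.\<close>
    have "(\<Sum>k<n. f ((T ^^ k) x)) \<le> \<bar>C\<bar> + c * real n" for n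
    proof (cases n)
      case (Suc m)
      have "(\<Sum>k<Suc m. f ((T ^^ k) x) - c) \<le> C"
        using sum_le_run_max[where f="\<lambda>x. f x - c" and n=m] C[of m] by (rule order_trans)
      then show ?thesis using Suc by (simp add: sum_subtractf algebra_simps)
    qed simp
    then show ?case by blast
  qed
qed

text \<open>The one-sided bound for \<open>f\<close> and for \<open>- f\<close> squeezes the
  averages. The slack runs through 1 / (m + 1), so only countably many null sets are
  discarded.\<close>

theorem birkhoff:
  assumes f: "integrable M f"
  shows "AE x in M. (\<lambda>n. (\<Sum>k<n. f ((T ^^ k) x)) / real n) \<longlonglongrightarrow> (\<integral>x. f x \<partial>M)"
proof -
  let ?S = "\<lambda>n x. \<Sum>k<n. f ((T ^^ k) x)" and ?E = "\<integral>x. f x \<partial>M" and ?e = "\<lambda>m. 1 / real (Suc m)"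
  have "AE x in M. \<forall>m. \<exists>C. \<forall>n. ?S n x \<le> C + (?E + ?e m) * real n"
    unfolding AE_all_countable by (intro allI AE_birkhoff_sum_le f) simp
  moreover have "AE x in M. \<forall>m. \<exists>C. \<forall>n. (\<Sum>k<n. - f ((T ^^ k) x)) \<le> C + (- ?E + ?e m) * real n"
    unfolding AE_all_countable using f by (intro allI AE_birkhoff_sum_le[where f="\<lambda>x. - f x"]) auto
  ultimately show ?thesis
  proof eventually_elim
    case (elim x)
    show ?case
    proof (rule LIMSEQ_I)
      fix r :: real assume "0 < r"
      then obtain m where m: "?e m < r / 2" using nat_approx_posE[of "r / 2"] by auto
      obtain C1 where C1: "\<And>n. ?S n x \<le> C1 + (?E + ?e m) * real n" using elim(1) by blast
      obtain C2 where "\<And>n. (\<Sum>k<n. - f ((T ^^ k) x)) \<le> C2 + (- ?E + ?e m) * real n" using elim(2) by blast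
      then have C2: "- ?S n x \<le> C2 + (- ?E + ?e m) * real n" for n by (simp add: sum_negf)
      obtain N where N: "2 * (\<bar>C1\<bar> + \<bar>C2\<bar>) / r < real N" using reals_Archimedean2 by blast
      have "norm (?S n x / real n - ?E) < r" if n: "n \<ge> Suc N" for n
      proof -
        have n0: "real n > 0" using n by simp
        have "2 * (\<bar>C1\<bar> + \<bar>C2\<bar>) < r * real N" using N \<open>0 < r\<close> by (simp add: field_simps)
        also have "\<dots> \<le> r * real n" using n \<open>0 < r\<close> by simp
        finally have C: "\<bar>C1\<bar> + \<bar>C2\<bar> < r / 2 * real n" by simp
        have m': "?e m * real n \<le> r / 2 * real n" using m by (intro mult_right_mono) auto
        have "?S n x \<le> C1 + (?E * real n + ?e m * real n)"
          using C1[of n] by (simp only: distrib_right)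
        then have "?S n x - ?E * real n < r * real n"
          using C m' by linarith
        moreover have "- ?S n x \<le> C2 + (- ?E * real n + ?e m * real n)"
          using C2[of n] by (simp only: distrib_right)
        then have "- (?S n x - ?E * real n) < r * real n"
          using C m' by linarith
        ultimately have "\<bar>?S n x - ?E * real n\<bar> < r * real n" by linarith
        moreover have "?S n x / real n - ?E = (?S n x - ?E * real n) / real n"
          using n0 by (simp add: field_simps)
        ultimately show ?thesis using n0 by (simp add: field_simps)
      qed
      then show "\<exists>no. \<forall>n\<ge>no. norm (?S n x / real n - ?E) < r" by blast
    qed
  qed
qed

text \<open>The tail deviation \<open>F N\<close> is one fixed integrable function that majorizes
  all errors of index at least \<open>N\<close>, so Birkhoff's theorem applies to it; its integral
  tends to 0 by dominated convergence. Hence n goes to infinity with \<open>N\<close> fixed, where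
  \<open>N\<close> is chosen to make this integral small.\<close>

theorem maker:
  assumes [measurable]: "\<And>n. u n \<in> borel_measurable M" "v \<in> borel_measurable M"
    and g: "integrable M g"
    and bound: "AE x in M. \<forall>n. \<bar>u n x\<bar> \<le> g x"
    and lim: "AE x in M. (\<lambda>n. u n x) \<longlonglongrightarrow> v x"
  shows "AE x in M. (\<lambda>n. (\<Sum>k<n. u (n - k) ((T ^^ k) x)) / real n) \<longlonglongrightarrow> (\<integral>x. v x \<partial>M)"
proof -
  have [measurable]: "g \<in> borel_measurable M" using g by auto
  have bound': "AE x in M. \<bar>v x\<bar> \<le> g x"
    using bound lim
  proof eventually_elim
    case (elim x)
    have "(\<lambda>n. \<bar>u n x\<bar>) \<longlonglongrightarrow> \<bar>v x\<bar>" using elim(2) by (intro tendsto_intros)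
    then show ?case using elim(1) by (intro LIMSEQ_le_const2) auto
  qed
  have v: "integrable M v"
    using bound' by (intro Bochner_Integration.integrable_bound[OF g]) auto
  \<comment> \<open>The truncation keeps the supremum finite at every point, including the exceptional ones.\<close>
  define F where "F = (\<lambda>N x. SUP n. min \<bar>u (N + n) x - v x\<bar> (2 * \<bar>g x\<bar>))"
  have bdd: "bdd_above (range (\<lambda>n. min \<bar>u (N + n) x - v x\<bar> (2 * \<bar>g x\<bar>)))" for N x
    by (intro bdd_aboveI[of _ "2 * \<bar>g x\<bar>"]) auto
  have [measurable]: "F N \<in> borel_measurable M" for N
    unfolding F_def using bdd by (intro borel_measurable_cSUP) auto
  have F0: "0 \<le> F N x" for N x
    unfolding F_def by (intro cSUP_upper2[OF bdd, of 0]) auto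
  have F1: "F N x \<le> 2 * \<bar>g x\<bar>" for N x
    unfolding F_def by (intro cSUP_least) auto
  have F: "integrable M (F N)" for N
  proof (rule Bochner_Integration.integrable_bound[of M "\<lambda>x. 2 * \<bar>g x\<bar>"])
    show "AE x in M. norm (F N x) \<le> norm (2 * \<bar>g x\<bar>)" using F0 F1 by (intro AE_I2) simp
  qed (use g in simp_all)
  have "(\<lambda>N. \<integral>x. F N x \<partial>M) \<longlonglongrightarrow> (\<integral>x. 0 \<partial>M)"
  proof (intro integral_dominated_convergence[where w="\<lambda>x. 2 * \<bar>g x\<bar>"])
    show "AE x in M. (\<lambda>N. F N x) \<longlonglongrightarrow> 0"
      using lim
    proof eventually_elim
      case (elim x)
      show ?case
      proof (rule LIMSEQ_I)
        fix r :: real assume "0 < r"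
        then obtain N where N: "\<And>n. n \<ge> N \<Longrightarrow> norm (u n x - v x) < r / 2"
          using LIMSEQ_D[OF elim, of "r / 2"] by auto
        have "F n x \<le> r / 2" if "n \<ge> N" for n
          unfolding F_def
        proof (rule cSUP_least)
          fix i show "min \<bar>u (n + i) x - v x\<bar> (2 * \<bar>g x\<bar>) \<le> r / 2"
            using N[of "n + i"] that by (intro min.coboundedI1) simp
        qed simp
        then have "norm (F n x - 0) < r" if "n \<ge> N" for n
          using that F0[of n x] \<open>0 < r\<close> by fastforce
        then show "\<exists>no. \<forall>n\<ge>no. norm (F n x - 0) < r" by blast
      qed
    qed
    show "AE x in M. norm (F N x) \<le> 2 * \<bar>g x\<bar>" for N using F0 F1 by (intro AE_I2) simp
  qed (use g in auto)
  then have limF: "(\<lambda>N. \<integral>x. F N x \<partial>M) \<longlonglongrightarrow> 0" by simp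
  let ?S = "\<lambda>f n x. \<Sum>k<n. f ((T ^^ k) x)"
  have "AE x in M. \<forall>N. (\<lambda>n. ?S (F N) n x / real n) \<longlonglongrightarrow> (\<integral>x. F N x \<partial>M)"
    unfolding AE_all_countable by (intro allI birkhoff F)
  moreover have "AE x in M. (\<lambda>n. ?S v n x / real n) \<longlonglongrightarrow> (\<integral>x. v x \<partial>M)"
    by (rule birkhoff[OF v])
  moreover have "AE x in M. (\<lambda>n. ?S g n x / real n) \<longlonglongrightarrow> (\<integral>x. g x \<partial>M)"
    by (rule birkhoff[OF g])
  moreover note AE_funpow[OF bound] AE_funpow[OF bound']
  ultimately show ?thesis
  proof eventually_elim
    case (elim x)
    have g0: "0 \<le> g ((T ^^ k) x)" for k
      using elim(5)[rule_format, of k] by linarith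
    \<comment> \<open>A single term of a sum with convergent averages is the difference of two
      consecutive sums, so divided by n it tends to 0.\<close>
    have "(\<lambda>n. ?S g (Suc n) x / real (Suc n) * (real (Suc n) / real n) - ?S g n x / real n) \<longlonglongrightarrow>
        (\<integral>x. g x \<partial>M) * 1 - (\<integral>x. g x \<partial>M)"
      by (intro tendsto_intros LIMSEQ_Suc[OF elim(3)] LIMSEQ_Suc_n_over_n elim(3))
    then have "(\<lambda>n. ?S g (Suc n) x / real (Suc n) * (real (Suc n) / real n) - ?S g n x / real n) \<longlonglongrightarrow> 0"
      by simp
    moreover have "?S g (Suc n) x / real (Suc n) * (real (Suc n) / real n) - ?S g n x / real n
        = g ((T ^^ n) x) / real n" for n
    proof -
      have "?S g (Suc n) x / real (Suc n) * (real (Suc n) / real n) = ?S g (Suc n) x / real n"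
        by (simp del: of_nat_Suc sum.lessThan_Suc)
      then show ?thesis by (simp add: add_divide_distrib)
    qed
    ultimately have gn: "(\<lambda>n. g ((T ^^ n) x) / real n) \<longlonglongrightarrow> 0" by simp
    have gnj: "(\<lambda>n. g ((T ^^ (n - j)) x) / real n) \<longlonglongrightarrow> 0" for j
    proof (rule Lim_null_comparison)
      have "(\<lambda>n. g ((T ^^ (n + j - j)) x) / real (n + j - j)) \<longlonglongrightarrow> 0" using gn by simp
      then show "(\<lambda>n. g ((T ^^ (n - j)) x) / real (n - j)) \<longlonglongrightarrow> 0"
        using LIMSEQ_offset[of "\<lambda>n. g ((T ^^ (n - j)) x) / real (n - j)" j] by simp
      have "norm (g ((T ^^ (n - j)) x) / real n) \<le> g ((T ^^ (n - j)) x) / real (n - j)" if "n > j" for n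
        using that g0[of "n - j"] by (auto intro!: divide_left_mono)
      then show "\<forall>\<^sub>F n in sequentially. norm (g ((T ^^ (n - j)) x) / real n) \<le> g ((T ^^ (n - j)) x) / real (n - j)"
        using eventually_gt_at_top[of j] by (rule eventually_mono[rotated]) 
    qed
    \<comment> \<open>The error is at most \<open>F N\<close> for the terms with \<open>n - k \<ge> N\<close>, and the last \<open>N\<close> terms are
      negligible since \<open>g\<close> grows sublinearly along the orbit.\<close>
    let ?d = "\<lambda>n k. u (n - k) ((T ^^ k) x) - v ((T ^^ k) x)"
    have d2g: "\<bar>?d n k\<bar> \<le> 2 * g ((T ^^ k) x)" for n k
      using elim(4)[rule_format, of "n - k" k] elim(5)[rule_format, of k] by linarith
    have dF: "\<bar>?d n k\<bar> \<le> F N ((T ^^ k) x)" if "n - k \<ge> N" for n k N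
    proof -
      have "\<bar>?d n k\<bar> = min \<bar>u (N + (n - k - N)) ((T ^^ k) x) - v ((T ^^ k) x)\<bar> (2 * \<bar>g ((T ^^ k) x)\<bar>)"
        using d2g[of n k] g0[of k] le_add_diff_inverse[OF that] by simp
      also have "\<dots> \<le> F N ((T ^^ k) x)" unfolding F_def by (rule cSUP_upper[OF _ bdd]) simp
      finally show ?thesis .
    qed
    have main: "\<bar>(\<Sum>k<n. ?d n k)\<bar> \<le> ?S (F N) n x + (\<Sum>j\<le>N. 2 * g ((T ^^ (n - j)) x))" if "n > N" for n N
    proof -
      have "\<bar>(\<Sum>k<n. ?d n k)\<bar> \<le> (\<Sum>k<n. \<bar>?d n k\<bar>)" by (rule sum_abs)
      also have "\<dots> = (\<Sum>k<n - N. \<bar>?d n k\<bar>) + (\<Sum>k\<in>{n - N..<n}. \<bar>?d n k\<bar>)"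
        by (subst sum.union_disjoint[symmetric]) (auto intro!: sum.cong)
      also have "(\<Sum>k<n - N. \<bar>?d n k\<bar>) \<le> (\<Sum>k<n - N. F N ((T ^^ k) x))"
        by (intro sum_mono dF) auto
      also have "\<dots> \<le> ?S (F N) n x" using F0 by (intro sum_mono2) auto
      also have "(\<Sum>k\<in>{n - N..<n}. \<bar>?d n k\<bar>) \<le> (\<Sum>k\<in>{n - N..<n}. 2 * g ((T ^^ k) x))"
        by (intro sum_mono d2g)
      \<comment> \<open>Counting from the end makes the number of terms independent of n. The value
        \<open>j = 0\<close> adds the index n itself, which is harmless as \<open>g\<close> is
        nonnegative along the orbit.\<close>
      also have "\<dots> \<le> (\<Sum>k\<in>(\<lambda>j. n - j) ` {..N}. 2 * g ((T ^^ k) x))"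
      proof (rule sum_mono2)
        show "{n - N..<n} \<subseteq> (\<lambda>j. n - j) ` {..N}"
        proof
          fix k assume "k \<in> {n - N..<n}"
          then show "k \<in> (\<lambda>j. n - j) ` {..N}" by (intro image_eqI[of _ _ "n - k"]) auto
        qed
      qed (use g0 in simp_all)
      also have "\<dots> = (\<Sum>j\<le>N. 2 * g ((T ^^ (n - j)) x))"
        using that by (subst sum.reindex) (auto intro!: inj_onI)
      finally show ?thesis by simp
    qed
    have "(\<lambda>n. (\<Sum>k<n. ?d n k) / real n) \<longlonglongrightarrow> 0"
    proof (rule LIMSEQ_I)
      fix r :: real assume "0 < r"
      then obtain N where N: "(\<integral>x. F N x \<partial>M) < r"
        using eventually_happens'[OF sequentially_bot order_tendstoD(2)[OF limF]] by blast
      have "(\<lambda>n. ?S (F N) n x / real n + (\<Sum>j\<le>N. 2 * (g ((T ^^ (n - j)) x) / real n)))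
          \<longlonglongrightarrow> (\<integral>x. F N x \<partial>M) + (\<Sum>j\<le>N. 2 * 0)"
        by (intro tendsto_intros gnj elim(1)[rule_format])
      then have "\<forall>\<^sub>F n in sequentially. ?S (F N) n x / real n + (\<Sum>j\<le>N. 2 * (g ((T ^^ (n - j)) x) / real n)) < r"
        by (rule order_tendstoD(2)) (use N in simp)
      then have "\<forall>\<^sub>F n in sequentially. norm ((\<Sum>k<n. ?d n k) / real n - 0) < r"
        using eventually_gt_at_top[of N]
      proof eventually_elim
        case (elim n)
        have "norm ((\<Sum>k<n. ?d n k) / real n - 0) = \<bar>\<Sum>k<n. ?d n k\<bar> / real n" by simp
        also have "\<dots> \<le> (?S (F N) n x + (\<Sum>j\<le>N. 2 * g ((T ^^ (n - j)) x))) / real n"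
          using main[OF elim(2)] by (intro divide_right_mono) auto
        also have "\<dots> = ?S (F N) n x / real n + (\<Sum>j\<le>N. 2 * (g ((T ^^ (n - j)) x) / real n))"
          by (simp add: add_divide_distrib sum_divide_distrib)
        finally show ?case using elim(1) by linarith
      qed
      then show "\<exists>no. \<forall>n\<ge>no. norm ((\<Sum>k<n. ?d n k) / real n - 0) < r"
        by (simp add: eventually_sequentially)
    qed
    from tendsto_add[OF this elim(2)] show ?case
      by (simp add: sum_subtractf diff_divide_distrib)
  qed
qed

end

section \<open>Differentiation of measures on the line\<close>

text \<open>Stated with measurable covers because the set where \<open>P\<close> fails is not
  assumed measurable; the intersection of covers with measure tending to 0 is the null set
  required.\<close>

lemma (in finite_measure) AE_if_small_exceptional_sets:
  assumes "\<And>\<delta>::real. 0 < \<delta> \<Longrightarrow> \<exists>N\<in>sets M. {x\<in>space M. \<not> P x} \<subseteq> N \<and> measure M N \<le> \<delta>"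
  shows "AE x in M. P x"
proof -
  have "\<exists>N\<in>sets M. {x\<in>space M. \<not> P x} \<subseteq> N \<and> measure M N \<le> 1 / real (Suc n)" for n
    using assms[of "1 / real (Suc n)"] by simp
  then obtain N where N: "\<And>n. N n \<in> sets M" "\<And>n. {x\<in>space M. \<not> P x} \<subseteq> N n"
    "\<And>n. measure M (N n) \<le> 1 / real (Suc n)" by metis
  have sets: "(\<Inter>n. N n) \<in> sets M" using N(1) by auto
  have "measure M (\<Inter>n. N n) \<le> 1 / real (Suc n)" for n
    using N(1) by (intro order_trans[OF finite_measure_mono N(3)]) auto
  then have "measure M (\<Inter>n. N n) \<le> 0"
    by (intro LIMSEQ_le_const[OF LIMSEQ_Suc[OF lim_1_over_n]]) auto
  then have "emeasure M (\<Inter>n. N n) = 0"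
    by (simp add: emeasure_eq_measure measure_le_0_iff)
  then have "(\<Inter>n. N n) \<in> null_sets M" using sets by auto
  then show ?thesis using N(2) by (intro AE_I'[of "\<Inter>n. N n"]) auto
qed

locale finite_borel_measure = finite_measure M for M :: "real measure" +
  assumes sets_borel [measurable_cong, simp]: "sets M = sets borel"
begin

lemma space_UNIV [simp]: "space M = UNIV"
  using sets_eq_imp_space_eq[OF sets_borel] by simp

lemma integrable_indicator_times:
  "integrable M f \<Longrightarrow> B \<in> sets borel \<Longrightarrow> integrable M (\<lambda>y. indicator B y * f y)" for f :: "real \<Rightarrow> real"
  using integrable_mult_indicator[of B M f] by simp

lemma measurable_interval_integral [measurable]:
  assumes [measurable]: "h \<in> borel_measurable borel"
  shows "(\<lambda>x. \<integral>y. indicator {x - r<..<x + r} y * h y \<partial>M :: real) \<in> borel_measurable borel"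
proof -
  have "(\<lambda>(x, y). (if x - r < y \<and> y < x + r then 1 else 0 :: real) * h y) \<in> borel_measurable (borel \<Otimes>\<^sub>M M)"
    by measurable
  from borel_measurable_lebesgue_integral[OF this]
  show ?thesis by (simp add: indicator_def of_bool_def)
qed

lemma measure_interval: "measure M {x - r<..<x + r} = (\<integral>y. indicator {x - r<..<x + r} y * (1::real) \<partial>M)"
  by simp

lemma measurable_measure_interval [measurable]:
  "(\<lambda>x. measure M {x - r<..<x + r}) \<in> borel_measurable borel"
  unfolding measure_interval by measurable

text \<open>The covering inequality is applied with the zero measure for comparison: at a point with
  a null interval around it, \<open>M\<close> is dominated by zero there. This makes later quotients
  and logarithms meaningful.\<close>

lemma AE_measure_interval_pos:
  assumes s: "\<And>n::nat. 0 < s n"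
  shows "AE x in M. \<forall>n. 0 < measure M {x - s n<..<x + s n}"
proof -
  let ?A = "{x. \<exists>n. measure M {x - s n<..<x + s n} = 0}"
  have [measurable]: "?A \<in> sets borel" by measurable
  have "emeasure M ?A \<le> 2 * emeasure (density M (\<lambda>_. 0)) UNIV"
  proof (rule emeasure_le_of_centred_intervals)
    fix x assume "x \<in> ?A"
    then obtain n where "measure M {x - s n<..<x + s n} = 0" by auto
    then show "\<exists>r>0. emeasure M {x - r<..<x + r} \<le> emeasure (density M (\<lambda>_. 0)) {x - r<..<x + r}"
      using s[of n] by (intro exI[of _ "s n"]) (simp add: emeasure_eq_measure)
  qed (auto intro: finite_measure_axioms)
  also have "\<dots> = 0" by (subst emeasure_density) auto
  finally have "emeasure M ?A = 0" by simp
  then have "?A \<in> null_sets M" by auto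
  then show ?thesis
    by (intro AE_I'[of ?A]) (auto simp: zero_less_measure_iff)
qed

text \<open>The Hardy-Littlewood maximal inequality with \<open>M\<close> in place of Lebesgue
  measure; the comparison measure has density \<open>h / t\<close>. A sequence of radii keeps the
  exceptional set measurable.\<close>

lemma measure_maximal_le:
  assumes "integrable M h" and [measurable]: "h \<in> borel_measurable borel"
    and h: "\<And>x. 0 \<le> h x" and s: "\<And>n::nat. 0 < s n" and t: "0 < t"
  shows "measure M {x. \<exists>n. t * measure M {x - s n<..<x + s n} \<le> (\<integral>y. indicator {x - s n<..<x + s n} y * h y \<partial>M)}
    \<le> 2 / t * (\<integral>x. h x \<partial>M)" (is "measure M ?A \<le> _")
proof -
  have [measurable]: "?A \<in> sets borel" by measurable
  let ?\<beta> = "density M (\<lambda>x. ennreal (h x / t))"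
  have \<beta>: "emeasure ?\<beta> B = ennreal ((\<integral>y. indicator B y * h y \<partial>M) / t)" if [measurable]: "B \<in> sets borel" for B
  proof -
    have int: "integrable M (\<lambda>y. indicator B y * h y)"
      using assms(1) by (rule integrable_indicator_times) simp
    have "emeasure ?\<beta> B = (\<integral>\<^sup>+y. ennreal (indicator B y * h y / t) \<partial>M)"
      by (subst emeasure_density) (auto intro!: nn_integral_cong simp: indicator_def)
    also have "\<dots> = ennreal (\<integral>y. indicator B y * h y / t \<partial>M)"
      using int h t by (intro nn_integral_eq_integral) auto
    finally show ?thesis by simp
  qed
  have "emeasure M ?A \<le> 2 * emeasure ?\<beta> UNIV"
  proof (rule emeasure_le_of_centred_intervals)
    fix x assume "x \<in> ?A"
    then obtain n where n: "t * measure M {x - s n<..<x + s n} \<le> (\<integral>y. indicator {x - s n<..<x + s n} y * h y \<partial>M)"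
      by auto
    then have "measure M {x - s n<..<x + s n} \<le> (\<integral>y. indicator {x - s n<..<x + s n} y * h y \<partial>M) / t"
      using t by (simp add: field_simps)
    then show "\<exists>r>0. emeasure M {x - r<..<x + r} \<le> emeasure ?\<beta> {x - r<..<x + r}"
      using s[of n] \<beta> by (intro exI[of _ "s n"]) (simp add: emeasure_eq_measure ennreal_leI)
  qed (auto intro: finite_measure_axioms)
  also have "\<dots> = ennreal (2 / t * (\<integral>x. h x \<partial>M))"
    using t h by (simp add: \<beta> ennreal_mult[symmetric] integral_nonneg flip: ennreal_numeral)
  finally show ?thesis
    using t h by (simp add: emeasure_eq_measure integral_nonneg)
qed

text \<open>Here the roles are exchanged: the measure with density \<open>w\<close> is the one
  estimated, and \<open>t\<close> times \<open>M\<close> is the comparison. Seen from the weight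
  \<open>w\<close> itself, small averages of \<open>w\<close> are rare, which later controls
  logarithms of averages.\<close>

lemma integral_minimal_le:
  assumes [measurable]: "w \<in> borel_measurable borel" and w: "\<And>x. 0 \<le> w x \<and> w x \<le> 1"
    and s: "\<And>n::nat. 0 < s n" and t: "0 < t"
  shows "(\<integral>y. indicator {x. \<exists>n. (\<integral>y. indicator {x - s n<..<x + s n} y * w y \<partial>M) \<le> t * measure M {x - s n<..<x + s n}} y * w y \<partial>M)
    \<le> 2 * t * measure M UNIV" (is "(\<integral>y. indicator ?A y * w y \<partial>M) \<le> _")
proof -
  have [measurable]: "?A \<in> sets borel" by measurable
  have wi: "integrable M w" using w by (intro integrable_const_bound[where B=1]) auto
  let ?\<alpha> = "density M (\<lambda>x. ennreal (w x))" and ?\<beta> = "density M (\<lambda>x. ennreal t)"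
  have \<alpha>: "emeasure ?\<alpha> B = ennreal (\<integral>y. indicator B y * w y \<partial>M)" if [measurable]: "B \<in> sets borel" for B
  proof -
    have "emeasure ?\<alpha> B = (\<integral>\<^sup>+y. ennreal (indicator B y * w y) \<partial>M)"
      by (subst emeasure_density) (auto intro!: nn_integral_cong simp: indicator_def)
    also have "\<dots> = ennreal (\<integral>y. indicator B y * w y \<partial>M)"
      using w by (intro nn_integral_eq_integral integrable_indicator_times wi) auto
    finally show ?thesis .
  qed
  have \<beta>: "emeasure ?\<beta> B = ennreal (t * measure M B)" if [measurable]: "B \<in> sets borel" for B
    using t by (subst emeasure_density) (auto simp: nn_integral_cmult_indicator emeasure_eq_measure ennreal_mult)
  have "emeasure ?\<alpha> ?A \<le> 2 * emeasure ?\<beta> UNIV"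
  proof (rule emeasure_le_of_centred_intervals)
    show "finite_measure ?\<alpha>" by (rule finite_measureI) (simp add: \<alpha>)
    fix x assume "x \<in> ?A"
    then obtain n where n: "(\<integral>y. indicator {x - s n<..<x + s n} y * w y \<partial>M) \<le> t * measure M {x - s n<..<x + s n}"
      by auto
    then show "\<exists>r>0. emeasure ?\<alpha> {x - r<..<x + r} \<le> emeasure ?\<beta> {x - r<..<x + r}"
      using s[of n] by (intro exI[of _ "s n"]) (simp add: \<alpha> \<beta> ennreal_leI)
  qed auto
  also have "\<dots> = ennreal (2 * t * measure M UNIV)"
    using t by (simp add: \<beta> ennreal_mult mult.assoc flip: ennreal_numeral)
  finally show ?thesis
    using t by (simp add: \<alpha>)
qed

lemma interval_integral_diff_bound:
  assumes "integrable M p" "integrable M q" "\<And>y. y \<in> {x - r<..<x + r} \<Longrightarrow> \<bar>p y - q y\<bar> \<le> e"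
  shows "\<bar>(\<integral>y. indicator {x - r<..<x + r} y * p y \<partial>M) - (\<integral>y. indicator {x - r<..<x + r} y * q y \<partial>M)\<bar>
    \<le> e * measure M {x - r<..<x + r}"
proof -
  note int = integrable_indicator_times[where B="{x - r<..<x + r}"]
  have "(\<integral>y. indicator {x - r<..<x + r} y * p y \<partial>M) - (\<integral>y. indicator {x - r<..<x + r} y * q y \<partial>M)
    = (\<integral>y. indicator {x - r<..<x + r} y * (p y - q y) \<partial>M)"
    using int[OF assms(1)] int[OF assms(2)]
    by (subst Bochner_Integration.integral_diff[symmetric]) (auto simp: right_diff_distrib)
  also have "\<bar>\<dots>\<bar> \<le> (\<integral>y. \<bar>indicator {x - r<..<x + r} y * (p y - q y)\<bar> \<partial>M)"
    by (rule integral_abs_bound)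
  also have "\<dots> \<le> (\<integral>y. indicator {x - r<..<x + r} y * e \<partial>M)"
    using int[of "\<lambda>y. p y - q y"] int[of "\<lambda>y. e"] assms
    by (intro integral_mono) (auto simp: indicator_def)
  finally show ?thesis by (simp add: mult.commute)
qed

text \<open>For a continuous function the averages converge at every point. The maximal inequality
  bounds the averages of the difference between \<open>p\<close> and a continuous approximation, and
  Markov's inequality bounds that difference at the point itself.\<close>

theorem differentiation:
  assumes [measurable]: "p \<in> borel_measurable borel" and p01: "\<And>x. 0 \<le> p x \<and> p x \<le> 1"
    and s: "\<And>n::nat. 0 < s n" and s0: "s \<longlonglongrightarrow> 0"
  shows "AE x in M. (\<lambda>n. (\<integral>y. indicator {x - s n<..<x + s n} y * p y \<partial>M) / measure M {x - s n<..<x + s n}) \<longlonglongrightarrow> p x"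
proof -
  let ?I = "\<lambda>h x n. \<integral>y. indicator {x - s n<..<x + s n} y * h y \<partial>M" and ?m = "\<lambda>x n. measure M {x - s n<..<x + s n}"
  have p: "integrable M p" using p01 by (intro integrable_const_bound[where B=1]) auto
  \<comment> \<open>Multiplied out by the mass, the estimate makes sense for null intervals too;
    division waits until the masses are known to be positive. The factor 3 counts three errors:
    \<open>p\<close> against \<open>g\<close> on the interval, \<open>g\<close> against
    \<open>g x\<close>, and \<open>g x\<close> against \<open>p x\<close>.\<close>
  have ae: "AE x in M. \<forall>\<^sub>F n in sequentially. \<bar>?I p x n - p x * ?m x n\<bar> \<le> 3 * e * ?m x n" if "e > 0" for e
  proof (rule AE_if_small_exceptional_sets)
    fix \<delta> :: real assume "0 < \<delta>"
    \<comment> \<open>The maximal inequality contributes \<open>2 / e\<close> and Markov's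
      inequality \<open>1 / e\<close> times the L1 error, together \<open>3 / e\<close>.\<close>
    then have "\<delta> * e / 3 > 0" using \<open>e > 0\<close> by simp
    then obtain g where g: "continuous_on UNIV g" "\<And>x. 0 \<le> g x \<and> g x \<le> 1" "(\<integral>x. \<bar>p x - g x\<bar> \<partial>M) < \<delta> * e / 3"
      using L1_approx_unit_continuous[OF finite_measure_axioms sets_borel assms(1) p01 \<open>\<delta> * e / 3 > 0\<close>]
      by blast
    have [measurable]: "g \<in> borel_measurable borel" using g(1) by (rule borel_measurable_continuous_onI)
    have gi: "integrable M g" using g(2) by (intro integrable_const_bound[where B=1]) auto
    let ?h = "\<lambda>x. \<bar>p x - g x\<bar>"
    have hi: "integrable M ?h" using p gi by auto
    define N1 where "N1 = {x. \<exists>n. e * ?m x n \<le> ?I ?h x n}"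
    define N2 where "N2 = {x. e \<le> ?h x}"
    have [measurable]: "N1 \<in> sets borel" "N2 \<in> sets borel" unfolding N1_def N2_def by measurable
    have "measure M N1 \<le> 2 / e * (\<integral>x. ?h x \<partial>M)"
      unfolding N1_def by (rule measure_maximal_le[OF hi _ _ s \<open>e > 0\<close>]) auto
    moreover have "measure M N2 \<le> (\<integral>x. ?h x \<partial>M) / e"
      using integral_Markov_inequality_measure[OF hi, of "UNIV" e] \<open>e > 0\<close>
      by (simp add: N2_def)
    ultimately have "measure M N1 + measure M N2 \<le> 3 / e * (\<integral>x. ?h x \<partial>M)"
      by (simp add: field_simps)
    also have "\<dots> \<le> 3 / e * (\<delta> * e / 3)" using g(3) \<open>e > 0\<close> by (intro mult_left_mono) auto
    also have "\<dots> = \<delta>" using \<open>e > 0\<close> by simp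
    finally have "measure M (N1 \<union> N2) \<le> \<delta>" by (intro order_trans[OF measure_Un_le]) auto
    moreover have "\<forall>\<^sub>F n in sequentially. \<bar>?I p x n - p x * ?m x n\<bar> \<le> 3 * e * ?m x n" if x: "x \<notin> N1 \<union> N2" for x
    proof -
      have "isCont g x" using g(1) by (simp add: continuous_on_eq_continuous_at)
      then obtain d where d: "d > 0" "\<And>y. \<bar>y - x\<bar> < d \<Longrightarrow> \<bar>g y - g x\<bar> < e"
        using \<open>e > 0\<close> unfolding continuous_at_eps_delta dist_real_def by blast
      have "\<forall>\<^sub>F n in sequentially. s n < d" using order_tendstoD(2)[OF s0 d(1)] .
      then show ?thesis
      proof eventually_elim
        case (elim n)
        have "?I p x n - ?I g x n = (\<integral>y. indicator {x - s n<..<x + s n} y * (p y - g y) \<partial>M)"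
          using integrable_indicator_times[OF p] integrable_indicator_times[OF gi]
          by (subst Bochner_Integration.integral_diff[symmetric]) (auto simp: right_diff_distrib)
        also have "\<bar>\<dots>\<bar> \<le> (\<integral>y. \<bar>indicator {x - s n<..<x + s n} y * (p y - g y)\<bar> \<partial>M)"
          by (rule integral_abs_bound)
        also have "\<dots> = ?I ?h x n" by (simp add: abs_mult)
        also have "\<dots> \<le> e * ?m x n" using x by (auto simp: N1_def not_le less_imp_le)
        finally have 1: "\<bar>?I p x n - ?I g x n\<bar> \<le> e * ?m x n" .
        have 2: "\<bar>?I g x n - ?I (\<lambda>_. g x) x n\<bar> \<le> e * ?m x n"
          using d(2) elim gi by (intro interval_integral_diff_bound) (auto intro!: less_imp_le simp: abs_less_iff)
        have "\<bar>g x - p x\<bar> * ?m x n \<le> e * ?m x n"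
          using x by (intro mult_right_mono) (auto simp: N2_def)
        then have 3: "\<bar>g x * ?m x n - p x * ?m x n\<bar> \<le> e * ?m x n"
          by (simp add: abs_mult left_diff_distrib[symmetric])
        show ?case using 1 2 3 by (simp add: mult.commute[of _ "g x"])
      qed
    qed
    ultimately show "\<exists>N\<in>sets M. {x\<in>space M. \<not> (\<forall>\<^sub>F n in sequentially. \<bar>?I p x n - p x * ?m x n\<bar> \<le> 3 * e * ?m x n)} \<subseteq> N \<and> measure M N \<le> \<delta>"
      by (intro bexI[of _ "N1 \<union> N2"]) auto
  qed
  have "AE x in M. \<forall>k. \<forall>\<^sub>F n in sequentially. \<bar>?I p x n - p x * ?m x n\<bar> \<le> 3 * (1 / real (Suc k)) * ?m x n"
    unfolding AE_all_countable by (intro allI ae) simp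
  with AE_measure_interval_pos[of s, OF s] show ?thesis
  proof eventually_elim
    case (elim x)
    show ?case
    proof (rule tendstoI)
      fix r :: real assume "r > 0"
      then obtain k where k: "1 / real (Suc k) < r / 3" using nat_approx_posE[of "r / 3"] by auto
      show "\<forall>\<^sub>F n in sequentially. dist (?I p x n / ?m x n) (p x) < r"
        using elim(2)[rule_format, of k]
      proof eventually_elim
        case (elim n)
        have m: "?m x n > 0" using \<open>\<forall>n. 0 < ?m x n\<close> by simp
        have "3 * (1 / real (Suc k)) * ?m x n < r * ?m x n" using k m by (intro mult_strict_right_mono) auto
        then have "\<bar>?I p x n - p x * ?m x n\<bar> < r * ?m x n" using elim by linarith
        moreover have "?I p x n / ?m x n - p x = (?I p x n - p x * ?m x n) / ?m x n" using m by (simp add: field_simps)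
        ultimately show ?case using m by (simp add: dist_real_def pos_divide_less_eq)
      qed
    qed
  qed
qed

end

section \<open>The shift on coin sequences\<close>

definition coin_shift :: "(nat \<Rightarrow> real) \<Rightarrow> nat \<Rightarrow> real" where
  "coin_shift \<xi> = (\<lambda>n. \<xi> (Suc n))"

abbreviation coin :: "real measure" where
  "coin \<equiv> measure_pmf (pmf_of_set {-1, 1})"

interpretation coin: sequence_space coin
  by unfold_locales

lemma coin_space_eq: "coin_space = coin.S"
  by (simp add: coin_space_def)

lemma space_coin_space [simp]: "space coin_space = UNIV"
  by (simp add: coin_space_def space_PiM)

lemma funpow_shift: "(coin_shift ^^ k) \<xi> n = \<xi> (n + k)"
  by (induction k arbitrary: \<xi>) (simp_all add: coin_shift_def funpow_swap1)

lemma measurable_coordinate [measurable]: "(\<lambda>\<xi>. \<xi> n) \<in> measurable coin_space coin"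
  unfolding coin_space_def by (rule measurable_component_singleton) simp

lemma measurable_coordinate_borel [measurable]: "(\<lambda>\<xi>. \<xi> n) \<in> borel_measurable coin_space"
  by (rule measurable_compose[OF measurable_coordinate]) simp

lemma distr_coordinate: "distr coin_space coin (\<lambda>\<xi>. \<xi> n) = coin"
  unfolding coin_space_def by (rule distr_PiM_component) (auto intro: measure_pmf.prob_space_axioms)

lemma measurable_shift [measurable]: "coin_shift \<in> measurable coin_space coin_space"
proof -
  have "coin_shift \<in> measurable coin_space coin.S"
    unfolding coin_shift_def by (rule measurable_PiM_single'[OF measurable_coordinate]) auto
  then show ?thesis by (simp add: coin_space_eq)
qed

lemma distr_shift: "distr coin_space coin_space coin_shift = coin_space"
  using distr_PiM_reindex[of UNIV "\<lambda>_. coin" Suc UNIV]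
  by (simp add: coin_space_def coin_shift_def[abs_def] measure_pmf.prob_space_axioms restrict_UNIV)

text \<open>Putting an independent coin in front of a coin sequence preserves the law, and under
  this map the event pulls back to the rectangle of \<open>{i}\<close> and \<open>A\<close>.\<close>

lemma measure_first_coin:
  assumes A: "A \<in> sets coin_space" and i: "i \<in> {-1, 1}"
  shows "measure coin_space {\<xi>. \<xi> 0 = i \<and> coin_shift \<xi> \<in> A} = measure coin_space A / 2"
proof -
  interpret prob_space coin_space by (rule prob_space_coin_space)
  have [measurable]: "A \<in> sets coin_space" by fact
  have [measurable]: "{\<xi>. \<xi> 0 = i \<and> coin_shift \<xi> \<in> A} \<in> sets coin_space"
    using measurable_sets[OF measurable_shift A] measurable_sets[OF measurable_coordinate[of 0], of "{i}"]
    by (simp add: Collect_conj_eq vimage_def)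
  have case_nat: "(\<lambda>(s, \<xi>). case_nat s \<xi>) \<in> measurable (coin \<Otimes>\<^sub>M coin_space) coin_space"
    unfolding coin_space_def by measurable
  have "emeasure coin_space {\<xi>. \<xi> 0 = i \<and> coin_shift \<xi> \<in> A}
    = emeasure (distr (coin \<Otimes>\<^sub>M coin_space) coin_space (\<lambda>(s, \<xi>). case_nat s \<xi>)) {\<xi>. \<xi> 0 = i \<and> coin_shift \<xi> \<in> A}"
    using coin.PiM_iter by (simp add: coin_space_def)
  also have "\<dots> = emeasure (coin \<Otimes>\<^sub>M coin_space) ({i} \<times> A)"
    by (subst emeasure_distr[OF case_nat])
       (fact, auto intro!: arg_cong[where f="emeasure _"] simp: space_pair_measure coin_shift_def)
  also have "\<dots> = emeasure coin {i} * emeasure coin_space A"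
    by (rule emeasure_pair_measure_Times) auto
  also have "emeasure coin {i} = ennreal (1 / 2)"
    using i by (auto simp: emeasure_pmf_single)
  also have "ennreal (1 / 2) * emeasure coin_space A = ennreal (measure coin_space A / 2)"
    unfolding emeasure_eq_measure by (subst ennreal_mult[symmetric]) auto
  finally show ?thesis by (simp add: emeasure_eq_measure)
qed

text \<open>A strictly invariant set is its own preimage under every iterate of the shift, so for
  each n it is determined by the coordinates from n on. It is therefore a tail event, and
  Kolmogorov's 0-1 law applies.\<close>

lemma coin_space_invariant_trivial:
  assumes A: "A \<in> sets coin_space" "coin_shift -` A = A"
  shows "measure coin_space A = 0 \<or> measure coin_space A = 1"
proof -
  interpret prob_space coin_space by (rule prob_space_coin_space)
  define \<A> where "\<A> = (\<lambda>i::nat. sigma_sets UNIV {(\<lambda>\<xi>. \<xi> i) -` B \<inter> UNIV |B. B \<in> sets coin} :: (nat \<Rightarrow> real) set set)"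
  have "indep_vars (\<lambda>_. coin) (\<lambda>i \<xi>. \<xi> i) UNIV"
    by (subst indep_vars_iff_distr_eq_PiM')
       (simp_all only: measurable_coordinate distr_coordinate restrict_UNIV coin_space_def[symmetric],
        simp_all add: distr_id2)
  then have "indep_sets \<A> UNIV"
    unfolding indep_vars_def \<A>_def by simp
  moreover have "sigma_algebra (space coin_space) (\<A> i)" for i
    unfolding \<A>_def by (simp add: sigma_algebra_sigma_sets)
  moreover have "A \<in> tail_events \<A>"
    unfolding tail_events_def
  proof (intro INT_I)
    fix n
    let ?N = "sigma UNIV (\<Union>(\<A> ` {n..}))"
    have "(coin_shift ^^ n) \<in> measurable ?N coin.S"
    proof -
      have "(\<lambda>\<xi> i. (coin_shift ^^ n) \<xi> i) \<in> measurable ?N coin.S"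
      proof (rule measurable_PiM_single')
        fix i
        show "(\<lambda>\<xi>. (coin_shift ^^ n) \<xi> i) \<in> measurable ?N coin"
        proof (rule measurableI)
          fix B :: "real set" assume "B \<in> sets coin"
          have "(\<lambda>\<xi>. (coin_shift ^^ n) \<xi> i) -` B \<inter> space ?N = (\<lambda>\<xi>. \<xi> (i + n)) -` B \<inter> UNIV"
            by (auto simp: funpow_shift)
          also have "\<dots> \<in> \<A> (i + n)" unfolding \<A>_def by (intro sigma_sets.Basic) auto
          finally show "(\<lambda>\<xi>. (coin_shift ^^ n) \<xi> i) -` B \<inter> space ?N \<in> sets ?N"
            by (subst sets_measure_of) (auto intro!: sigma_sets.Basic bexI[of _ "i + n"])
        qed simp
      qed simp
      then show ?thesis by simp
    qed
    moreover have "A \<in> sets coin.S" using A(1) by (simp add: coin_space_eq)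
    ultimately have "(coin_shift ^^ n) -` A \<inter> space ?N \<in> sets ?N" by (rule measurable_sets)
    moreover have "(coin_shift ^^ n) -` A = A"
    proof (induction n)
      case (Suc n)
      have "(coin_shift ^^ Suc n) -` A = (coin_shift ^^ n) -` (coin_shift -` A)" by auto
      then show ?case using A(2) Suc by (simp only:)
    qed simp
    ultimately show "A \<in> sigma_sets (space coin_space) (\<Union>(\<A> ` {n..}))"
      by (simp add: sets_measure_of)
  qed
  ultimately show ?thesis by (intro kolmogorov_0_1_law)
qed

interpretation shift: ergodic_map coin_space coin_shift
proof -
  interpret prob_space coin_space by (rule prob_space_coin_space)
  show "ergodic_map coin_space coin_shift"
    by unfold_locales (auto simp: distr_shift coin_space_invariant_trivial)
qed

section \<open>The random series on sequences of signs\<close>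

definition good :: "(nat \<Rightarrow> real) \<Rightarrow> bool" where
  "good \<xi> \<longleftrightarrow> (\<forall>n. \<xi> n \<in> {-1, 1})"

lemma AE_good: "AE \<xi> in coin_space. good \<xi>"
  using AE_coin_space by (simp add: good_def)

lemma good_shift: "good \<xi> \<Longrightarrow> good (coin_shift \<xi>)"
  by (simp add: good_def coin_shift_def)

lemma good_abs: "good \<xi> \<Longrightarrow> \<bar>\<xi> n\<bar> = 1"
  by (auto simp: good_def dest!: spec[of _ n])

definition bsum :: "real \<Rightarrow> (nat \<Rightarrow> real) \<Rightarrow> real" where
  "bsum l \<xi> = (\<Sum>n. \<xi> n * l ^ n)"

lemma measurable_bsum [measurable]: "bsum l \<in> borel_measurable coin_space"
  unfolding bsum_def[abs_def] by (rule measurable_bernoulli_sum)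

lemma bernoulli_conv_eq: "bernoulli_conv l = distr coin_space borel (bsum l)"
  by (simp add: bernoulli_conv_def bsum_def[abs_def])

lemma summable_bsum:
  assumes "good \<xi>" "\<bar>l\<bar> < 1"
  shows "summable (\<lambda>n. \<xi> n * l ^ n)"
  using assms by (intro summable_comparison_test'[OF summable_geometric[of "\<bar>l\<bar>"], of 0])
    (auto simp: abs_mult good_abs power_abs)

lemma abs_bsum_le:
  assumes "good \<xi>" "0 < l" "l < 1"
  shows "\<bar>bsum l \<xi>\<bar> \<le> 1 / (1 - l)"
proof -
  have "norm (\<xi> n * l ^ n) = l ^ n" for n using assms by (simp add: abs_mult good_abs)
  moreover have "summable (\<lambda>n. l ^ n)" using assms by (intro summable_geometric) auto
  ultimately have "norm (bsum l \<xi>) \<le> (\<Sum>n. l ^ n)"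
    unfolding bsum_def using summable_norm[of "\<lambda>n. \<xi> n * l ^ n"] by simp
  also have "\<dots> = 1 / (1 - l)" using assms by (intro suminf_geometric) auto
  finally show ?thesis by simp
qed

lemma bsum_shift:
  assumes "good \<xi>" "0 < l" "l < 1"
  shows "bsum l \<xi> = \<xi> 0 + l * bsum l (coin_shift \<xi>)"
proof -
  have "bsum l \<xi> = \<xi> 0 + (\<Sum>n. \<xi> (Suc n) * l ^ Suc n)"
    unfolding bsum_def using suminf_split_head[OF summable_bsum[of \<xi> l]] assms by simp
  also have "(\<Sum>n. \<xi> (Suc n) * l ^ Suc n) = (\<Sum>n. l * (coin_shift \<xi> n * l ^ n))"
    by (intro suminf_cong) (simp add: coin_shift_def)
  also have "\<dots> = l * bsum l (coin_shift \<xi>)"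
    unfolding bsum_def using assms by (intro suminf_mult summable_bsum good_shift) auto
  finally show ?thesis .
qed

lemma bsum_tendsto:
  assumes g: "good \<xi>" and l: "0 < l" "l < 1" and \<eta>: "\<eta> \<longlonglongrightarrow> l"
  shows "(\<lambda>n. bsum (\<eta> n) \<xi>) \<longlonglongrightarrow> bsum l \<xi>"
proof -
  have "isCont (\<lambda>x. bsum x \<xi>) l"
    unfolding bsum_def
    \<comment> \<open>The power series converges at \<open>(1 + l) / 2\<close>, which lies strictly
      between \<open>l\<close> and 1.\<close>
    by (rule isCont_powser[where K="(1 + l) / 2"]) (use l g in \<open>auto intro!: summable_bsum\<close>)
  then show ?thesis using \<eta> by (rule isCont_tendsto_compose)
qed

section \<open>The first coin given the sum\<close>

text \<open>The laws of \<open>X\<close> restricted to the two values of the first coin are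
  absolutely continuous with respect to \<mu> and add up to it, so their Radon-Nikodym densities sum
  to 1 almost everywhere and a single function describes both.\<close>

lemma has_conditional_density:
  fixes X :: "(nat \<Rightarrow> real) \<Rightarrow> real"
  assumes [measurable]: "X \<in> borel_measurable coin_space"
  defines "\<mu> \<equiv> distr coin_space borel X"
  shows "\<exists>p. p \<in> borel_measurable borel \<and> (\<forall>x. 0 \<le> p x \<and> p x \<le> (1::real)) \<and>
    (\<forall>i\<in>{-1, 1}. distr (density coin_space (indicator {\<xi>. \<xi> 0 = i})) borel X
      = density \<mu> (\<lambda>x. ennreal (if i = 1 then p x else 1 - p x)))"
proof -
  interpret prob_space coin_space by (rule prob_space_coin_space)
  have [measurable_cong]: "sets \<mu> = sets borel" by (simp add: \<mu>_def)
  interpret \<mu>: prob_space \<mu> unfolding \<mu>_def by (rule prob_space.prob_space_distr[OF prob_space_coin_space]) simp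
  define \<nu> where "\<nu> = (\<lambda>i. distr (density coin_space (indicator {\<xi>. \<xi> 0 = i})) borel X)"
  have S [measurable]: "{\<xi>. \<xi> 0 = i} \<in> sets coin_space" for i :: real
    using measurable_sets[OF measurable_coordinate_borel[of 0], of "{i}"] by (simp add: vimage_def)
  have \<nu>: "emeasure (\<nu> i) A = emeasure coin_space ({\<xi>. \<xi> 0 = i} \<inter> X -` A)" if [measurable]: "A \<in> sets borel" for i A
  proof -
    have "X -` A \<in> sets coin_space" using measurable_sets[OF assms(1) that] by simp
    then show ?thesis
      unfolding \<nu>_def
      by (simp add: emeasure_distr emeasure_density indicator_inter_arith[symmetric] S sets.Int)
  qed
  have "\<exists>f\<in>borel_measurable \<mu>. density \<mu> f = \<nu> i" for i
  proof (rule \<mu>.Radon_Nikodym_finite_measure)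
    show "finite_measure (\<nu> i)"
    proof (rule finite_measureI)
      have "space (\<nu> i) = UNIV" by (simp add: \<nu>_def)
      then show "emeasure (\<nu> i) (space (\<nu> i)) \<noteq> \<infinity>" by (simp add: \<nu>)
    qed
    show "sets (\<nu> i) = sets \<mu>" by (simp add: \<nu>_def \<mu>_def)
    show "absolutely_continuous \<mu> (\<nu> i)"
      unfolding absolutely_continuous_def
    proof
      fix A assume A: "A \<in> null_sets \<mu>"
      then have [measurable]: "A \<in> sets borel" by (auto simp: \<mu>_def)
      have "X -` A \<in> sets coin_space" using measurable_sets[OF assms(1), of A] by simp
      moreover have "emeasure coin_space (X -` A) = 0"
        using A by (auto simp: \<mu>_def emeasure_distr)
      ultimately have "emeasure coin_space ({\<xi>. \<xi> 0 = i} \<inter> X -` A) = 0"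
        by (meson emeasure_eq_0 inf_le2)
      then show "A \<in> null_sets (\<nu> i)" by (intro null_setsI) (simp_all add: \<nu>, simp add: \<nu>_def)
    qed
  qed
  then obtain f where f: "\<And>i. f i \<in> borel_measurable \<mu>" "\<And>i. density \<mu> (f i) = \<nu> i" by metis
  then have f' [measurable]: "f i \<in> borel_measurable borel" for i
    using measurable_cong_sets[OF \<open>sets \<mu> = sets borel\<close> refl] by blast
  have "density \<mu> (\<lambda>x. f 1 x + f (-1) x) = \<mu>"
  proof (rule measure_eqI)
    fix A assume "A \<in> sets (density \<mu> (\<lambda>x. f 1 x + f (-1) x))"
    then have [measurable]: "A \<in> sets borel" by (simp add: \<mu>_def)
    have XA: "X -` A \<in> sets coin_space" using measurable_sets[OF assms(1), of A] by simp
    have "emeasure (density \<mu> (\<lambda>x. f 1 x + f (-1) x)) A = emeasure (density \<mu> (f 1)) A + emeasure (density \<mu> (f (-1))) A"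
    proof -
      have A: "A \<in> sets \<mu>" by (simp add: \<mu>_def)
      have "(\<lambda>x. f i x * indicator A x) \<in> borel_measurable \<mu>" for i
        using f(1) A by (intro borel_measurable_times_ennreal borel_measurable_indicator)
      then show ?thesis
        by (simp add: emeasure_density[OF _ A] f(1) borel_measurable_add distrib_right nn_integral_add)
    qed
    also have "\<dots> = emeasure coin_space ({\<xi>. \<xi> 0 = 1} \<inter> X -` A) + emeasure coin_space ({\<xi>. \<xi> 0 = -1} \<inter> X -` A)"
      by (simp add: f(2) \<nu>)
    also have "\<dots> = emeasure coin_space ({\<xi>. \<xi> 0 = 1} \<inter> X -` A \<union> {\<xi>. \<xi> 0 = -1} \<inter> X -` A)"
      using XA S by (intro plus_emeasure sets.Int) auto
    also have "\<dots> = emeasure coin_space (X -` A)"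
    proof (rule emeasure_eq_AE)
      show "AE \<xi> in coin_space. \<xi> \<in> {\<xi>. \<xi> 0 = 1} \<inter> X -` A \<union> {\<xi>. \<xi> 0 = -1} \<inter> X -` A \<longleftrightarrow> \<xi> \<in> X -` A"
        using AE_good by eventually_elim (auto simp: good_def)
    qed (use XA S in auto)
    finally show "emeasure (density \<mu> (\<lambda>x. f 1 x + f (-1) x)) A = emeasure \<mu> A"
      by (simp add: \<mu>_def emeasure_distr)
  qed simp
  then have "density \<mu> (\<lambda>x. f 1 x + f (-1) x) = density \<mu> (\<lambda>_. 1)" by (simp add: density_1)
  then have sum1: "AE x in \<mu>. f 1 x + f (-1) x = 1"
    by (subst (asm) \<mu>.density_unique_iff) (auto intro!: borel_measurable_add f(1))
  \<comment> \<open>Truncation changes the density on a null set only and makes it finite and at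
    most 1 at every point.\<close>
  define p where "p = (\<lambda>x. enn2real (min 1 (f 1 x)))"
  have p01: "0 \<le> p x \<and> p x \<le> 1" for x
    unfolding p_def by (auto intro!: enn2real_leI)
  have [measurable]: "p \<in> borel_measurable borel" unfolding p_def by measurable
  have AE: "AE x in \<mu>. f i x = ennreal (if i = 1 then p x else 1 - p x)" if "i \<in> {-1, 1}" for i :: real
    using sum1
  proof eventually_elim
    case (elim x)
    have "f 1 x \<le> 1" using elim by (metis le_iff_add)
    then have 1: "f 1 x = ennreal (p x)"
      unfolding p_def by (subst ennreal_enn2real) (auto simp: min_def top_unique intro: le_less_trans)
    have "f (-1) x = 1 - f 1 x"
      unfolding elim[symmetric] using 1 by (simp add: ennreal_add_diff_cancel_left)
    also have "\<dots> = ennreal (1 - p x)"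
      using p01[of x] unfolding 1 by (simp add: ennreal_minus flip: ennreal_1)
    finally show ?case using 1 that by auto
  qed
  have "\<nu> i = density \<mu> (\<lambda>x. ennreal (if i = 1 then p x else 1 - p x))" if "i \<in> {-1, 1}" for i
    unfolding f(2)[symmetric]
  proof (rule density_cong[OF f(1) _ AE[OF that]])
    show "(\<lambda>x. ennreal (if i = 1 then p x else 1 - p x)) \<in> borel_measurable \<mu>"
      unfolding measurable_cong_sets[OF \<open>sets \<mu> = sets borel\<close> refl] by measurable
  qed
  then show ?thesis using p01 by (intro exI[of _ p]) (auto simp: \<nu>_def)
qed

locale bernoulli =
  fixes l :: real
  assumes l0: "0 < l" and l1: "l < 1"
begin

abbreviation "X \<equiv> bsum l"
abbreviation "\<mu> \<equiv> bernoulli_conv l"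

sublocale M: prob_space \<mu> by (rule prob_space_bernoulli_conv)

sublocale M: finite_borel_measure \<mu>
  by unfold_locales (simp add: bernoulli_conv_def)

lemma measurable_mu: "F \<in> borel_measurable borel \<Longrightarrow> F \<in> borel_measurable \<mu>"
  by (subst measurable_cong_sets[OF M.sets_borel refl])

definition cond_prob_1 :: "real \<Rightarrow> real" where
  "cond_prob_1 = (SOME p. p \<in> borel_measurable borel \<and> (\<forall>x. 0 \<le> p x \<and> p x \<le> (1::real)) \<and>
    (\<forall>i\<in>{-1, 1}. distr (density coin_space (indicator {\<xi>. \<xi> 0 = i})) borel X
      = density \<mu> (\<lambda>x. ennreal (if i = 1 then p x else 1 - p x))))"

text \<open>Meaningful for \<open>i \<in> {-1, 1}\<close> only; every \<open>i \<noteq> 1\<close> is treated like \<open>-1\<close>.\<close>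

definition cond :: "real \<Rightarrow> real \<Rightarrow> real" where
  "cond i x = (if i = 1 then cond_prob_1 x else 1 - cond_prob_1 x)"

lemma cond_prob_1:
  "cond_prob_1 \<in> borel_measurable borel" "0 \<le> cond_prob_1 x" "cond_prob_1 x \<le> 1"
  "i \<in> {-1, 1} \<Longrightarrow> distr (density coin_space (indicator {\<xi>. \<xi> 0 = i})) borel X = density \<mu> (\<lambda>x. ennreal (cond i x))"
  using someI_ex[OF has_conditional_density[OF measurable_bsum[of l], folded bernoulli_conv_eq]]
  unfolding cond_prob_1_def[symmetric] cond_def by auto

lemma measurable_cond [measurable]: "cond i \<in> borel_measurable borel"
  using cond_prob_1(1) unfolding cond_def[abs_def] by simp

lemma cond_01: "0 \<le> cond i x \<and> cond i x \<le> 1"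
  using cond_prob_1(2,3)[of x] by (auto simp: cond_def)

lemma measurable_first [measurable]: "{\<xi>. \<xi> 0 = i} \<in> sets coin_space" for i :: real
  using measurable_sets[OF measurable_coordinate_borel[of 0], of "{i}"] by (simp add: vimage_def)

lemma integral_first_coin:
  assumes [measurable]: "F \<in> borel_measurable borel" and i: "i \<in> {-1, 1}"
  shows "(\<integral>\<xi>. indicator {\<xi>. \<xi> 0 = i} \<xi> * F (X \<xi>) \<partial>coin_space) = (\<integral>x. cond i x * F x \<partial>\<mu>)" (is ?A)
    and "integrable coin_space (\<lambda>\<xi>. indicator {\<xi>. \<xi> 0 = i} \<xi> * F (X \<xi>)) \<longleftrightarrow> integrable \<mu> (\<lambda>x. cond i x * F x)" (is ?B)
proof -
  let ?D = "density coin_space (\<lambda>\<xi>. ennreal (indicat_real {\<xi>. \<xi> 0 = i} \<xi>))"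
  have D: "distr ?D borel X = density \<mu> (\<lambda>x. ennreal (cond i x))"
    using cond_prob_1(4)[OF i] by (simp add: ennreal_indicator)
  have "(\<integral>\<xi>. indicator {\<xi>. \<xi> 0 = i} \<xi> * F (X \<xi>) \<partial>coin_space) = (\<integral>\<xi>. F (X \<xi>) \<partial>?D)"
    by (subst integral_density) auto
  also have "\<dots> = (\<integral>x. F x \<partial>distr ?D borel X)" by (subst integral_distr) auto
  also have "\<dots> = (\<integral>x. cond i x * F x \<partial>\<mu>)"
    unfolding D by (subst integral_density) (auto simp: cond_01 intro!: measurable_mu)
  finally show ?A .
  have "integrable coin_space (\<lambda>\<xi>. indicator {\<xi>. \<xi> 0 = i} \<xi> * F (X \<xi>)) \<longleftrightarrow> integrable ?D (\<lambda>\<xi>. F (X \<xi>))"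
    by (subst integrable_density) auto
  also have "\<dots> \<longleftrightarrow> integrable (distr ?D borel X) F" by (subst integrable_distr_eq) auto
  also have "\<dots> \<longleftrightarrow> integrable \<mu> (\<lambda>x. cond i x * F x)"
    unfolding D by (subst integrable_density) (auto simp: cond_01 intro!: measurable_mu)
  finally show ?B .
qed

text \<open>Integrability is required only after weighting with \<open>cond i\<close>. This admits
  \<open>ln (cond i x)\<close>, which may be unbounded while \<open>cond i x * ln (cond i x)\<close>
  is bounded.\<close>

lemma integral_first_coin_sum:
  assumes F: "\<And>i. i \<in> {-1, 1} \<Longrightarrow> F i \<in> borel_measurable borel"
    and int: "\<And>i. i \<in> {-1, 1} \<Longrightarrow> integrable \<mu> (\<lambda>x. cond i x * F i x)"
    and m: "(\<lambda>\<xi>. F (\<xi> 0) (X \<xi>)) \<in> borel_measurable coin_space"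
  shows "(\<integral>\<xi>. F (\<xi> 0) (X \<xi>) \<partial>coin_space) = (\<integral>x. cond 1 x * F 1 x \<partial>\<mu>) + (\<integral>x. cond (-1) x * F (-1) x \<partial>\<mu>)"
proof -
  have [measurable]: "F 1 \<in> borel_measurable borel" "F (-1) \<in> borel_measurable borel" using F by auto
  let ?G = "\<lambda>i \<xi>. indicat_real {\<xi>. \<xi> 0 = i} \<xi> * F i (X \<xi>)"
  have "(\<integral>\<xi>. F (\<xi> 0) (X \<xi>) \<partial>coin_space) = (\<integral>\<xi>. ?G 1 \<xi> + ?G (-1) \<xi> \<partial>coin_space)"
  proof (rule integral_cong_AE)
    show "AE \<xi> in coin_space. F (\<xi> 0) (X \<xi>) = ?G 1 \<xi> + ?G (-1) \<xi>"
      using AE_good by eventually_elim (auto simp: good_def indicator_def dest!: spec[of _ 0])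
  qed (use m in auto)
  also have "\<dots> = (\<integral>\<xi>. ?G 1 \<xi> \<partial>coin_space) + (\<integral>\<xi>. ?G (-1) \<xi> \<partial>coin_space)"
    using integral_first_coin(2)[of "F 1" 1] integral_first_coin(2)[of "F (-1)" "-1"] int
    by (intro Bochner_Integration.integral_add) auto
  finally show ?thesis
    by (simp add: integral_first_coin(1))
qed

lemma prob_first_coin:
  assumes [measurable]: "A \<in> sets borel" and i: "i \<in> {-1, 1}"
  shows "measure coin_space {\<xi>. \<xi> 0 = i \<and> X \<xi> \<in> A} = (\<integral>x. indicator A x * cond i x \<partial>\<mu>)"
proof -
  have [measurable]: "{\<xi>. \<xi> 0 = i \<and> X \<xi> \<in> A} \<in> sets coin_space"
    using measurable_sets[OF measurable_bsum[of l] assms(1)] measurable_first[of i]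
    by (simp add: Collect_conj_eq vimage_def)
  have "measure coin_space {\<xi>. \<xi> 0 = i \<and> X \<xi> \<in> A} = (\<integral>\<xi>. indicator {\<xi>. \<xi> 0 = i \<and> X \<xi> \<in> A} \<xi> \<partial>coin_space)"
    by simp
  also have "\<dots> = (\<integral>\<xi>. indicator {\<xi>. \<xi> 0 = i} \<xi> * indicat_real A (X \<xi>) \<partial>coin_space)"
    by (intro Bochner_Integration.integral_cong) (auto simp: indicator_def)
  also have "\<dots> = (\<integral>x. cond i x * indicator A x \<partial>\<mu>)"
    by (rule integral_first_coin(1)[OF _ i]) simp
  finally show ?thesis by (simp add: mult.commute)
qed

lemma measure_bernoulli_conv:
  assumes "A \<in> sets borel"
  shows "measure \<mu> A = measure coin_space {\<xi>. X \<xi> \<in> A}"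
  unfolding bernoulli_conv_eq using assms by (simp add: measure_distr vimage_def)

end

section \<open>Exact dimensionality\<close>

text \<open>Passing from an almost sure statement about \<open>X\<close> to one about its law via
  \<open>AE_distr_iff\<close> asks for a measurable event.\<close>

lemma sets_Collect_tendsto:
  fixes f :: "nat \<Rightarrow> real \<Rightarrow> real"
  assumes [measurable]: "\<And>n. f n \<in> borel_measurable borel"
  shows "{x. (\<lambda>n. f n x) \<longlonglongrightarrow> c} \<in> sets borel"
proof -
  have "(\<lambda>n. f n x) \<longlonglongrightarrow> c \<longleftrightarrow> (\<forall>k. \<exists>N. \<forall>n. N \<le> n \<longrightarrow> \<bar>f n x - c\<bar> < 1 / real (Suc k))" for x
  proof
    assume "(\<lambda>n. f n x) \<longlonglongrightarrow> c"
    then show "\<forall>k. \<exists>N. \<forall>n. N \<le> n \<longrightarrow> \<bar>f n x - c\<bar> < 1 / real (Suc k)"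
      using LIMSEQ_D[of "\<lambda>n. f n x" c "1 / real (Suc _)"] by simp
  next
    assume *: "\<forall>k. \<exists>N. \<forall>n. N \<le> n \<longrightarrow> \<bar>f n x - c\<bar> < 1 / real (Suc k)"
    show "(\<lambda>n. f n x) \<longlonglongrightarrow> c"
    proof (rule LIMSEQ_I)
      fix r :: real assume "0 < r"
      then obtain k where k: "1 / real (Suc k) < r" using nat_approx_posE by blast
      obtain N where "\<forall>n. N \<le> n \<longrightarrow> \<bar>f n x - c\<bar> < 1 / real (Suc k)" using * by blast
      then show "\<exists>N. \<forall>n\<ge>N. norm (f n x - c) < r" using k by (intro exI[of _ N]) (auto intro: less_trans)
    qed
  qed
  then show ?thesis by simp
qed

text \<open>For r between the scales of index n + 1 and n, monotonicity puts the quotient between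
  two mixed quotients with indices n and n + 1. Both have the same limit, because shifting the index
  by one does not change a linear rate.\<close>

lemma tendsto_at_right_of_geometric_scales:
  fixes m :: "real \<Rightarrow> real"
  assumes mono: "\<And>r s. r \<le> s \<Longrightarrow> m r \<le> m s" and pos: "\<And>r. 0 < r \<Longrightarrow> 0 < m r" and le1: "\<And>r. m r \<le> 1"
    and l: "0 < l" "l < 1" and R: "0 < R"
    and lim: "(\<lambda>n. ln (m (R * l ^ n)) / real n) \<longlonglongrightarrow> - a"
  shows "((\<lambda>r. ln (m r) / ln r) \<longlongrightarrow> a / (- ln l)) (at_right 0)"
proof -
  define s where "s = (\<lambda>n. R * l ^ n)"
  have s_pos: "0 < s n" for n using l R by (simp add: s_def)
  have s0: "s \<longlonglongrightarrow> 0"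
    unfolding s_def using l by (intro tendsto_mult_right_zero LIMSEQ_power_zero) simp
  have lnl: "ln l < 0" using l by simp
  have lns: "(\<lambda>n. ln (s n) / real n) \<longlonglongrightarrow> ln l"
  proof -
    have "(\<lambda>n. ln R / real n + ln l) \<longlonglongrightarrow> 0 + ln l"
      by (intro tendsto_intros lim_const_over_n)
    moreover have "\<forall>\<^sub>F n in sequentially. ln R / real n + ln l = ln (s n) / real n"
      using eventually_gt_at_top[of 0]
      by eventually_elim (use l R in \<open>simp add: s_def ln_mult ln_realpow field_simps\<close>)
    ultimately show ?thesis using Lim_transform_eventually by fastforce
  qed
  have Suc_ratio: "(\<lambda>n. f (Suc n) / real n) \<longlonglongrightarrow> b" if "(\<lambda>n. f n / real n) \<longlonglongrightarrow> b" for f :: "nat \<Rightarrow> real" and b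
  proof -
    have "(\<lambda>n. f (Suc n) / real (Suc n) * (real (Suc n) / real n)) \<longlonglongrightarrow> b * 1"
      by (intro tendsto_intros LIMSEQ_Suc[OF that] LIMSEQ_Suc_n_over_n)
    then show ?thesis by (simp del: of_nat_Suc)
  qed
  have lim': "(\<lambda>n. ln (m (s n)) / real n) \<longlonglongrightarrow> - a" using lim by (simp add: s_def)
  let ?L = "a / (- ln l)"
  have lower: "(\<lambda>n. ln (m (s n)) / ln (s (Suc n))) \<longlonglongrightarrow> ?L"
  proof -
    have "(\<lambda>n. (ln (m (s n)) / real n) / (ln (s (Suc n)) / real n)) \<longlonglongrightarrow> - a / ln l"
      using lnl by (intro tendsto_divide lim' Suc_ratio[OF lns, of]) auto
    moreover have "\<forall>\<^sub>F n in sequentially. (ln (m (s n)) / real n) / (ln (s (Suc n)) / real n) = ln (m (s n)) / ln (s (Suc n))"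
      using eventually_gt_at_top[of 0] by eventually_elim simp
    ultimately show ?thesis using Lim_transform_eventually by fastforce
  qed
  have upper: "(\<lambda>n. ln (m (s (Suc n))) / ln (s n)) \<longlonglongrightarrow> ?L"
  proof -
    have "(\<lambda>n. (ln (m (s (Suc n))) / real n) / (ln (s n) / real n)) \<longlonglongrightarrow> - a / ln l"
      using lnl by (intro tendsto_divide Suc_ratio[OF lim'] lns) auto
    moreover have "\<forall>\<^sub>F n in sequentially. (ln (m (s (Suc n))) / real n) / (ln (s n) / real n) = ln (m (s (Suc n))) / ln (s n)"
      using eventually_gt_at_top[of 0] by eventually_elim simp
    ultimately show ?thesis using Lim_transform_eventually by fastforce
  qed
  show ?thesis
  proof (rule tendstoI)
    fix e :: real assume "0 < e"
    have "\<forall>\<^sub>F n in sequentially. ?L - e < ln (m (s n)) / ln (s (Suc n)) \<and> ln (m (s (Suc n))) / ln (s n) < ?L + e \<and> s n < 1"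
      using order_tendstoD(1)[OF lower, of "?L - e"] order_tendstoD(2)[OF upper, of "?L + e"]
        order_tendstoD(2)[OF s0, of 1] \<open>0 < e\<close>
      by (intro eventually_conj) auto
    then obtain N where N: "\<And>n. n \<ge> N \<Longrightarrow> ?L - e < ln (m (s n)) / ln (s (Suc n))"
      "\<And>n. n \<ge> N \<Longrightarrow> ln (m (s (Suc n))) / ln (s n) < ?L + e" "\<And>n. n \<ge> N \<Longrightarrow> s n < 1"
      unfolding eventually_sequentially by blast
    have "\<forall>\<^sub>F r in at_right 0. 0 < r \<and> r < s N"
      using s_pos[of N] by (auto simp: eventually_at_right_field)
    then show "\<forall>\<^sub>F r in at_right 0. dist (ln (m r) / ln r) ?L < e"
    proof eventually_elim
      case (elim r)
      have "\<exists>n. s n \<le> r"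
        using order_tendstoD(2)[OF s0, of r] elim by (auto simp: eventually_sequentially intro: less_imp_le)
      define k where "k = (LEAST n. s n \<le> r)"
      have k: "s k \<le> r" unfolding k_def using \<open>\<exists>n. s n \<le> r\<close> by (rule LeastI_ex)
      have k': "r < s n" if "n < k" for n using not_less_Least[of n "\<lambda>n. s n \<le> r"] that by (auto simp: k_def)
      have "decseq s" unfolding s_def decseq_def using l R by (auto intro!: power_decreasing)
      have "N < k"
      proof (rule ccontr)
        assume "\<not> N < k"
        then have "s N \<le> s k" using \<open>decseq s\<close> by (simp add: decseqD)
        then show False using k elim by simp
      qed
      then obtain n where n: "k = Suc n" "n \<ge> N" by (cases k) auto
      have sn: "s (Suc n) \<le> r" "r < s n" "s n < 1" using k k'[of n] n N(3)[of n] by auto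
      have neg: "ln r < 0" "ln (s n) < 0" "ln (s (Suc n)) < 0"
        using sn elim s_pos[of "Suc n"] s_pos[of n] by simp_all
      have lns: "ln (s (Suc n)) \<le> ln r" "ln r \<le> ln (s n)"
        using sn elim s_pos[of "Suc n"] by simp_all
      have lnm: "ln (m (s (Suc n))) \<le> ln (m r)" "ln (m r) \<le> ln (m (s n))"
        using sn elim s_pos[of "Suc n"] mono[of "s (Suc n)" r] mono[of r "s n"] pos by (auto intro!: ln_mono)
      have lnm0: "ln (m (s n)) \<le> 0" "ln (m r) \<le> 0" using le1 pos s_pos elim by auto
      have "ln (m (s n)) / ln (s (Suc n)) \<le> ln (m r) / ln r"
      proof -
        have "- ln (m (s n)) / - ln (s (Suc n)) \<le> - ln (m r) / - ln r"
          using neg lns lnm lnm0 by (intro frac_le) auto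
        then show ?thesis by simp
      qed
      moreover have "ln (m r) / ln r \<le> ln (m (s (Suc n))) / ln (s n)"
      proof -
        have "- ln (m r) / - ln r \<le> - ln (m (s (Suc n))) / - ln (s n)"
          using neg lns lnm lnm0 by (intro frac_le) auto
        then show ?thesis by simp
      qed
      ultimately show ?case
        using N(1,2)[OF n(2)] unfolding dist_real_def by linarith
    qed
  qed
qed

context bernoulli
begin

text \<open>The factor is chosen so that the interval of radius \<open>radius 0\<close> around any point of the support
  has full measure, see \<open>mass_0\<close>.\<close>

definition radius :: "nat \<Rightarrow> real" where
  "radius n = (2 / (1 - l) + 1) * l ^ n"

lemma radius_pos: "0 < radius n"
  using l0 l1 by (simp add: radius_def add_pos_pos)

lemma radius_tendsto_0: "radius \<longlonglongrightarrow> 0"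
  unfolding radius_def[abs_def] using l0 l1 by (intro tendsto_mult_right_zero LIMSEQ_power_zero) simp

abbreviation mass :: "nat \<Rightarrow> real \<Rightarrow> real" where
  "mass n x \<equiv> measure \<mu> {x - radius n<..<x + radius n}"

text \<open>By \<open>prob_first_coin\<close> the numerator is a joint probability, so for
  \<open>i\<close> equal to 1 or -1 this is the conditional probability of the first coin being
  \<open>i\<close> given that \<open>X\<close> falls in the interval.\<close>

definition cond_at :: "nat \<Rightarrow> real \<Rightarrow> real \<Rightarrow> real" where
  "cond_at n i x = (\<integral>y. indicator {x - radius n<..<x + radius n} y * cond i y \<partial>\<mu>) / mass n x"

lemma measurable_cond_at [measurable]: "cond_at n i \<in> borel_measurable borel"
  unfolding cond_at_def[abs_def] by measurable

lemma AE_X: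
  assumes "AE x in \<mu>. P x"
  shows "AE \<xi> in coin_space. P (X \<xi>)"
  using assms unfolding bernoulli_conv_eq by (intro AE_distrD[OF measurable_bsum])

lemma AE_mass_pos: "AE \<xi> in coin_space. \<forall>n. 0 < mass n (X \<xi>)"
  by (rule AE_X[OF M.AE_measure_interval_pos[of radius, OF radius_pos]])

lemma mass_0: "good \<xi> \<Longrightarrow> mass 0 (X \<xi>) = 1"
proof -
  assume \<xi>: "good \<xi>"
  have "AE \<zeta> in coin_space. X \<zeta> \<in> {X \<xi> - radius 0<..<X \<xi> + radius 0}"
    using AE_good
  proof eventually_elim
    case (elim \<zeta>)
    then show ?case
      \<comment> \<open>Two values of the series differ by at most 2 / (1 - l); the summand 1 in the
        radius makes the inclusion strict.\<close>
      using abs_bsum_le[OF \<xi> l0 l1] abs_bsum_le[OF elim l0 l1] by (auto simp: radius_def)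
  qed
  then have "AE x in \<mu>. x \<in> {X \<xi> - radius 0<..<X \<xi> + radius 0}"
    unfolding bernoulli_conv_eq by (subst AE_distr_iff) auto
  then show ?thesis by (subst M.prob_eq_1) auto
qed

lemma mass_times_cond_at:
  assumes \<xi>: "good \<xi>" and pos: "0 < mass (Suc n) (X \<xi>)"
  shows "mass (Suc n) (X \<xi>) * cond_at (Suc n) (\<xi> 0) (X \<xi>) = mass n (X (coin_shift \<xi>)) / 2"
proof -
  let ?I = "{X \<xi> - radius (Suc n)<..<X \<xi> + radius (Suc n)}"
  let ?J = "{X (coin_shift \<xi>) - radius n<..<X (coin_shift \<xi>) + radius n}"
  have i: "\<xi> 0 \<in> {-1, 1}" using \<xi> by (simp add: good_def)
  have J: "X -` ?J \<in> sets coin_space" using measurable_sets[OF measurable_bsum[of l], of ?J] by simp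
  have I: "X -` ?I \<in> sets coin_space" using measurable_sets[OF measurable_bsum[of l], of ?I] by simp
  have r: "radius (Suc n) = l * radius n" by (simp add: radius_def)
  have "mass (Suc n) (X \<xi>) * cond_at (Suc n) (\<xi> 0) (X \<xi>) = (\<integral>y. indicator ?I y * cond (\<xi> 0) y \<partial>\<mu>)"
    using pos by (simp add: cond_at_def)
  also have "\<dots> = measure coin_space {\<zeta>. \<zeta> 0 = \<xi> 0 \<and> X \<zeta> \<in> ?I}"
    by (rule prob_first_coin[OF _ i, symmetric]) simp
  also have "\<dots> = measure coin_space {\<zeta>. \<zeta> 0 = \<xi> 0 \<and> coin_shift \<zeta> \<in> X -` ?J}"
  proof (rule shift.finite_measure_eq_AE)
    show "AE \<zeta> in coin_space. \<zeta> \<in> {\<zeta>. \<zeta> 0 = \<xi> 0 \<and> X \<zeta> \<in> ?I} \<longleftrightarrow> \<zeta> \<in> {\<zeta>. \<zeta> 0 = \<xi> 0 \<and> coin_shift \<zeta> \<in> X -` ?J}"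
      using AE_good
    proof eventually_elim
      case (elim \<zeta>)
      have "X \<zeta> \<in> ?I \<longleftrightarrow> \<bar>X \<zeta> - X \<xi>\<bar> < radius (Suc n)" by (auto simp: abs_less_iff)
      also have "\<dots> \<longleftrightarrow> \<bar>X (coin_shift \<zeta>) - X (coin_shift \<xi>)\<bar> < radius n" if "\<zeta> 0 = \<xi> 0"
      proof -
        \<comment> \<open>The common first coin cancels, and the remaining factor \<open>l\<close>
          is the ratio of \<open>radius (Suc n)\<close> to \<open>radius n\<close>.\<close>
        have "X \<zeta> - X \<xi> = l * (X (coin_shift \<zeta>) - X (coin_shift \<xi>))"
          using bsum_shift[OF \<xi> l0 l1] bsum_shift[OF elim l0 l1] that by (simp add: right_diff_distrib)
        then show ?thesis using l0 by (simp add: r abs_mult)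
      qed
      also have "\<bar>X (coin_shift \<zeta>) - X (coin_shift \<xi>)\<bar> < radius n \<longleftrightarrow> coin_shift \<zeta> \<in> X -` ?J"
        by (auto simp: abs_less_iff)
      finally show ?case by auto
    qed
    show "{\<zeta>. \<zeta> 0 = \<xi> 0 \<and> X \<zeta> \<in> ?I} \<in> sets coin_space"
      using sets.Int[OF measurable_first I] by (simp add: Collect_conj_eq vimage_def)
    show "{\<zeta>. \<zeta> 0 = \<xi> 0 \<and> coin_shift \<zeta> \<in> X -` ?J} \<in> sets coin_space"
      using sets.Int[OF measurable_first measurable_sets[OF measurable_shift J]]
      by (simp add: Collect_conj_eq vimage_def)
  qed
  also have "\<dots> = measure coin_space (X -` ?J) / 2" by (rule measure_first_coin[OF J i])
  also have "measure coin_space (X -` ?J) = mass n (X (coin_shift \<xi>))"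
    by (subst measure_bernoulli_conv) (simp_all add: vimage_def)
  finally show ?thesis .
qed

text \<open>The negative of the usual information content of the first coin; hence the minus sign in
  \<open>cond_entropy\<close>.\<close>

definition info :: "nat \<Rightarrow> (nat \<Rightarrow> real) \<Rightarrow> real" where
  "info n \<xi> = ln (cond_at n (\<xi> 0) (X \<xi>))"

definition info_lim :: "(nat \<Rightarrow> real) \<Rightarrow> real" where
  "info_lim \<xi> = ln (cond (\<xi> 0) (X \<xi>))"

text \<open>The coordinate \<open>\<xi> 0\<close> is an arbitrary real number off the almost sure
  event, so measurability on all of \<open>coin_space\<close> needs a family \<open>F\<close> with
  two members only. This is why indices other than 1 are all treated like -1.\<close>

lemma measurable_first_case:
  assumes [measurable]: "F 1 \<in> borel_measurable borel" "F (-1) \<in> borel_measurable borel"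
    and eq: "\<And>i. i \<noteq> 1 \<Longrightarrow> F i = F (-1)"
  shows "(\<lambda>\<xi>. F (\<xi> 0) (X \<xi>) :: real) \<in> borel_measurable coin_space"
proof -
  have "(\<lambda>\<xi>. F (\<xi> 0) (X \<xi>)) = (\<lambda>\<xi>. if \<xi> \<in> {\<xi>. \<xi> 0 = 1} then F 1 (X \<xi>) else F (-1) (X \<xi>))"
  proof
    fix \<xi> :: "nat \<Rightarrow> real"
    show "F (\<xi> 0) (X \<xi>) = (if \<xi> \<in> {\<xi>. \<xi> 0 = 1} then F 1 (X \<xi>) else F (-1) (X \<xi>))"
      using eq[of "\<xi> 0"] by auto
  qed
  then show ?thesis by simp
qed

lemma cond_neg: "i \<noteq> 1 \<Longrightarrow> cond i = cond (-1)"
  by (simp add: cond_def[abs_def])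

lemma measurable_cond_first [measurable]: "(\<lambda>\<xi>. cond (\<xi> 0) (X \<xi>)) \<in> borel_measurable coin_space"
  by (rule measurable_first_case[of cond, OF _ _ cond_neg]) measurable

lemma measurable_cond_at_first [measurable]: "(\<lambda>\<xi>. cond_at n (\<xi> 0) (X \<xi>)) \<in> borel_measurable coin_space"
proof (rule measurable_first_case[of "cond_at n"])
  show "cond_at n i = cond_at n (-1)" if "i \<noteq> 1" for i
    unfolding cond_at_def[abs_def] cond_neg[OF that] ..
qed measurable

lemma measurable_info [measurable]: "info n \<in> borel_measurable coin_space"
  unfolding info_def[abs_def] by measurable

lemma measurable_info_lim [measurable]: "info_lim \<in> borel_measurable coin_space"
  unfolding info_lim_def[abs_def] by measurable

lemma AE_cond_at_tendsto: "AE \<xi> in coin_space. (\<lambda>n. cond_at n (\<xi> 0) (X \<xi>)) \<longlonglongrightarrow> cond (\<xi> 0) (X \<xi>)"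
proof -
  have "AE x in \<mu>. (\<lambda>n. cond_at n i x) \<longlonglongrightarrow> cond i x" for i
    unfolding cond_at_def
    by (rule M.differentiation[of "cond i" radius, OF measurable_cond cond_01 radius_pos radius_tendsto_0])
  from AE_X[OF this[of 1]] AE_X[OF this[of "-1"]] AE_good show ?thesis
    by eventually_elim (auto simp: good_def dest!: spec[of _ 0])
qed

lemma cond_at_le_1: "0 < mass n x \<Longrightarrow> cond_at n i x \<le> 1"
proof -
  assume pos: "0 < mass n x"
  have "(\<integral>y. indicator {x - radius n<..<x + radius n} y * cond i y \<partial>\<mu>)
      \<le> (\<integral>y. indicator {x - radius n<..<x + radius n} y * 1 \<partial>\<mu>)"
    using cond_01 by (intro integral_mono M.integrable_indicator_times M.integrable_const_bound[where B=1])
      (auto simp: indicator_def cond_01[THEN conjunct2] intro!: measurable_mu)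
  then show ?thesis using pos by (simp add: cond_at_def)
qed

section \<open>An integrable majorant for the logarithms\<close>

definition bad :: "nat \<Rightarrow> (nat \<Rightarrow> real) set" where
  "bad k = {\<xi>. \<exists>n. cond_at n (\<xi> 0) (X \<xi>) \<le> exp (- real k)}"

lemma measurable_bad [measurable]: "bad k \<in> sets coin_space"
proof -
  have "{\<xi> \<in> space coin_space. \<exists>n. cond_at n (\<xi> 0) (X \<xi>) \<le> exp (- real k)} \<in> sets coin_space" by measurable
  then show ?thesis by (simp add: bad_def)
qed

text \<open>The weight \<open>cond i\<close> in \<open>integral_minimal_le\<close> turns its left
  side into a joint probability with the first coin. The constant 4 is the factor 2 of that bound,
  once for each value of the coin.\<close>

lemma prob_bad: "measure coin_space (bad k) \<le> 4 * exp (- real k)"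
proof -
  let ?t = "exp (- real k)"
  let ?E = "\<lambda>i. {x. \<exists>n. (\<integral>y. indicator {x - radius n<..<x + radius n} y * cond i y \<partial>\<mu>) \<le> ?t * mass n x}"
  have [measurable]: "?E i \<in> sets borel" for i by measurable
  have E: "{\<xi>. \<xi> 0 = i \<and> X \<xi> \<in> ?E i} \<in> sets coin_space" for i
    using sets.Int[OF measurable_first measurable_sets[OF measurable_bsum[of l], of "?E i"], of i]
    by (simp add: Collect_conj_eq vimage_def)
  have le: "measure coin_space {\<xi>. \<xi> 0 = i \<and> X \<xi> \<in> ?E i} \<le> 2 * ?t" if i: "i \<in> {-1, 1}" for i
  proof -
    have "measure coin_space {\<xi>. \<xi> 0 = i \<and> X \<xi> \<in> ?E i} = (\<integral>x. indicator (?E i) x * cond i x \<partial>\<mu>)"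
      by (rule prob_first_coin[OF _ i]) measurable
    also have "\<dots> \<le> 2 * ?t * measure \<mu> UNIV"
      by (rule M.integral_minimal_le[of "cond i" radius, OF measurable_cond cond_01 radius_pos]) simp
    finally show ?thesis using M.prob_space by simp
  qed
  have "measure coin_space (bad k) \<le> measure coin_space ({\<xi>. \<xi> 0 = 1 \<and> X \<xi> \<in> ?E 1} \<union> {\<xi>. \<xi> 0 = -1 \<and> X \<xi> \<in> ?E (-1)})"
  proof (rule shift.finite_measure_mono_AE)
    show "AE \<xi> in coin_space. \<xi> \<in> bad k \<longrightarrow> \<xi> \<in> {\<xi>. \<xi> 0 = 1 \<and> X \<xi> \<in> ?E 1} \<union> {\<xi>. \<xi> 0 = -1 \<and> X \<xi> \<in> ?E (-1)}"
      using AE_good AE_mass_pos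
    proof eventually_elim
      case (elim \<xi>)
      show ?case
      proof
        assume "\<xi> \<in> bad k"
        then obtain n where "cond_at n (\<xi> 0) (X \<xi>) \<le> ?t" by (auto simp: bad_def)
        then have "(\<integral>y. indicator {X \<xi> - radius n<..<X \<xi> + radius n} y * cond (\<xi> 0) y \<partial>\<mu>) \<le> ?t * mass n (X \<xi>)"
          using elim(2) by (simp add: cond_at_def pos_divide_le_eq)
        then have "X \<xi> \<in> ?E (\<xi> 0)" by blast
        moreover have "\<xi> 0 = 1 \<or> \<xi> 0 = -1" using elim(1) by (auto simp: good_def)
        ultimately show "\<xi> \<in> {\<xi>. \<xi> 0 = 1 \<and> X \<xi> \<in> ?E 1} \<union> {\<xi>. \<xi> 0 = -1 \<and> X \<xi> \<in> ?E (-1)}" by auto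
      qed
    qed
  qed (use E in blast)
  also have "\<dots> \<le> 2 * ?t + 2 * ?t"
    by (rule order_trans[OF measure_Un_le[OF E E] add_mono[OF le le]]) auto
  finally show ?thesis by simp
qed

text \<open>Layer-cake form of the supremum of \<open>\<bar>info n \<xi>\<bar>\<close>: the sets
  \<open>bad k\<close> decrease, so almost surely the sum equals that supremum up to rounding, while
  its integral is a sum of probabilities.\<close>

definition info_bound :: "(nat \<Rightarrow> real) \<Rightarrow> real" where
  "info_bound \<xi> = (\<Sum>k. indicator (bad k) \<xi>)"

lemma summable_prob_bad: "summable (\<lambda>k. measure coin_space (bad k))"
proof (rule summable_comparison_test')
  show "summable (\<lambda>k. 4 * exp (- 1) ^ k :: real)" by (intro summable_mult summable_geometric) simp
  show "norm (measure coin_space (bad k)) \<le> 4 * exp (- 1) ^ k" for k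
    using prob_bad[of k] by (simp add: exp_of_nat_mult[symmetric])
qed

lemma AE_eventually_not_bad: "AE \<xi> in coin_space. \<forall>\<^sub>F k in sequentially. \<xi> \<notin> bad k"
proof -
  have "AE \<xi> in coin_space. \<forall>\<^sub>F k in sequentially. \<xi> \<in> space coin_space - bad k"
    by (rule borel_cantelli_AE1[OF measurable_bad _ summable_prob_bad]) (simp add: shift.emeasure_eq_measure)
  then show ?thesis by simp
qed

lemma AE_summable_bad: "AE \<xi> in coin_space. summable (\<lambda>k. indicat_real (bad k) \<xi>)"
  using AE_eventually_not_bad
proof eventually_elim
  case (elim \<xi>)
  then obtain K where "\<And>k. k \<ge> K \<Longrightarrow> \<xi> \<notin> bad k" by (auto simp: eventually_sequentially)
  then show ?case by (intro summable_finite[of "{..<K}"]) (auto simp: not_less)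
qed

lemma integrable_info_bound: "integrable coin_space info_bound"
  unfolding info_bound_def[abs_def]
proof (rule integrable_suminf)
  show "AE \<xi> in coin_space. summable (\<lambda>k. norm (indicat_real (bad k) \<xi>))"
    using AE_summable_bad by simp
  show "summable (\<lambda>k. \<integral>\<xi>. norm (indicat_real (bad k) \<xi>) \<partial>coin_space)"
    using summable_prob_bad by simp
  show "integrable coin_space (indicat_real (bad k))" for k
    by (rule integrable_real_indicator) (simp_all add: shift.emeasure_eq_measure)
qed

lemma AE_cond_at_bounds:
  "AE \<xi> in coin_space. \<forall>n. 0 < cond_at n (\<xi> 0) (X \<xi>) \<and> \<bar>info n \<xi>\<bar> \<le> info_bound \<xi> \<and> 0 < cond (\<xi> 0) (X \<xi>)"
  using AE_eventually_not_bad AE_summable_bad AE_mass_pos AE_cond_at_tendsto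
proof eventually_elim
  case (elim \<xi>)
  \<comment> \<open>A single \<open>K\<close> bounds the conditional probabilities below at all
    scales at once. This keeps their limit positive, so that \<open>ln\<close> is continuous
    there.\<close>
  obtain K where K: "\<xi> \<notin> bad K" using eventually_happens'[OF sequentially_bot elim(1)] by blast
  then have lower: "exp (- real K) < cond_at n (\<xi> 0) (X \<xi>)" for n by (auto simp: bad_def not_le)
  have pos: "0 < cond_at n (\<xi> 0) (X \<xi>)" for n using lower[of n] exp_gt_zero less_trans by blast
  have "exp (- real K) \<le> cond (\<xi> 0) (X \<xi>)"
    using lower by (intro LIMSEQ_le_const[OF elim(4)]) (auto intro!: less_imp_le)
  then have pos': "0 < cond (\<xi> 0) (X \<xi>)" using exp_gt_zero less_le_trans by blast
  have "\<bar>info n \<xi>\<bar> \<le> info_bound \<xi>" for n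
  proof -
    let ?c = "cond_at n (\<xi> 0) (X \<xi>)"
    have "?c \<le> 1" using elim(3) by (intro cond_at_le_1) simp
    then have "ln ?c \<le> 0" using pos[of n] by simp
    \<comment> \<open>The sets \<open>bad 0\<close> to \<open>bad m\<close> all contain
      \<open>\<xi>\<close>. Since the count starts at 0 it is at least \<open>m + 1\<close>, which
      makes up for rounding down.\<close>
    define m where "m = nat \<lfloor>- ln ?c\<rfloor>"
    have m: "real m \<le> - ln ?c" "- ln ?c \<le> real (Suc m)"
      using \<open>ln ?c \<le> 0\<close> unfolding m_def by linarith+
    have "\<xi> \<in> bad k" if "k \<le> m" for k
    proof -
      have "ln ?c \<le> - real k" using m(1) that by (simp add: le_minus_iff)
      then have "?c \<le> exp (- real k)" using pos[of n] by (metis exp_le_cancel_iff exp_ln)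
      then show ?thesis by (auto simp: bad_def)
    qed
    then have "(\<Sum>k\<le>m. indicat_real (bad k) \<xi>) = real (Suc m)" by simp
    moreover have "(\<Sum>k\<le>m. indicat_real (bad k) \<xi>) \<le> info_bound \<xi>"
      unfolding info_bound_def using elim(2) by (intro sum_le_suminf) auto
    ultimately show ?thesis using m(2) \<open>ln ?c \<le> 0\<close> by (simp add: info_def)
  qed
  then show ?case using pos pos' by blast
qed

lemma AE_info_tendsto: "AE \<xi> in coin_space. (\<lambda>n. info n \<xi>) \<longlonglongrightarrow> info_lim \<xi>"
  using AE_cond_at_bounds AE_cond_at_tendsto
proof eventually_elim
  case (elim \<xi>)
  then have "cond (\<xi> 0) (X \<xi>) \<noteq> 0" by (metis less_irrefl)
  then show ?case unfolding info_def info_lim_def using elim(2) by (intro tendsto_ln)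
qed

lemma integrable_info_lim: "integrable coin_space info_lim"
proof (rule Bochner_Integration.integrable_bound[OF integrable_info_bound])
  show "AE \<xi> in coin_space. norm (info_lim \<xi>) \<le> norm (info_bound \<xi>)"
    using AE_info_tendsto AE_cond_at_bounds
  proof eventually_elim
    case (elim \<xi>)
    have "(\<lambda>n. \<bar>info n \<xi>\<bar>) \<longlonglongrightarrow> \<bar>info_lim \<xi>\<bar>" using elim(1) by (intro tendsto_intros)
    then have "\<bar>info_lim \<xi>\<bar> \<le> info_bound \<xi>" using elim(2) by (intro LIMSEQ_le_const2) auto
    then show ?case by simp
  qed
qed simp

section \<open>The entropy formula for the dimension\<close>

definition cond_entropy :: real where
  "cond_entropy = - (\<integral>\<xi>. info_lim \<xi> \<partial>coin_space)"

lemma AE_mass_asymptotics: "AE \<xi> in coin_space. (\<lambda>n. ln (mass n (X \<xi>)) / real n) \<longlonglongrightarrow> - (ln 2 - cond_entropy)"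
proof -
  have "AE \<xi> in coin_space. (\<lambda>n. (\<Sum>k<n. info (n - k) ((coin_shift ^^ k) \<xi>)) / real n) \<longlonglongrightarrow> (\<integral>\<xi>. info_lim \<xi> \<partial>coin_space)"
  proof (rule shift.maker[OF measurable_info measurable_info_lim integrable_info_bound _ AE_info_tendsto])
    show "AE \<xi> in coin_space. \<forall>n. \<bar>info n \<xi>\<bar> \<le> info_bound \<xi>"
      using AE_cond_at_bounds by eventually_elim blast
  qed
  with shift.AE_funpow[OF AE_good] shift.AE_funpow[OF AE_mass_pos] shift.AE_funpow[OF AE_cond_at_bounds]
  show ?thesis
  proof eventually_elim
    case (elim \<xi>)
    have step: "ln (mass (Suc n) (X \<zeta>)) = ln (mass n (X (coin_shift \<zeta>))) - ln 2 - info (Suc n) \<zeta>"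
      if "\<zeta> = (coin_shift ^^ k) \<xi>" for n k \<zeta>
    proof -
      have g: "good \<zeta>" and m: "0 < mass (Suc n) (X \<zeta>)" and c: "0 < cond_at (Suc n) (\<zeta> 0) (X \<zeta>)"
        using elim(1-3) that by auto
      have "0 < mass n (X ((coin_shift ^^ Suc k) \<xi>))" using elim(2) by blast
      then have m': "0 < mass n (X (coin_shift \<zeta>))" using that by simp
      have "ln (mass (Suc n) (X \<zeta>) * cond_at (Suc n) (\<zeta> 0) (X \<zeta>)) = ln (mass n (X (coin_shift \<zeta>)) / 2)"
        by (simp only: mass_times_cond_at[OF g m])
      then show ?thesis using m m' c by (simp add: ln_mult ln_div info_def)
    qed
    \<comment> \<open>Each step lowers the scale and shifts the coins by one, so the induction needs
      every starting point \<open>j\<close> of the orbit. It ends at scale 0, where the mass is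
      1.\<close>
    have "ln (mass n (X ((coin_shift ^^ j) \<xi>))) = - real n * ln 2 - (\<Sum>k<n. info (n - k) ((coin_shift ^^ (j + k)) \<xi>))" for n j
    proof (induction n arbitrary: j)
      case 0
      show ?case using mass_0 elim(1) by simp
    next
      case (Suc n)
      have "ln (mass (Suc n) (X ((coin_shift ^^ j) \<xi>)))
          = ln (mass n (X ((coin_shift ^^ Suc j) \<xi>))) - ln 2 - info (Suc n) ((coin_shift ^^ j) \<xi>)"
        using step[OF refl, of j n] by simp
      also have "\<dots> = - real (Suc n) * ln 2 - (info (Suc n) ((coin_shift ^^ j) \<xi>) + (\<Sum>k<n. info (n - k) ((coin_shift ^^ (Suc j + k)) \<xi>)))"
        unfolding Suc.IH by (simp add: algebra_simps)
      also have "info (Suc n) ((coin_shift ^^ j) \<xi>) + (\<Sum>k<n. info (n - k) ((coin_shift ^^ (Suc j + k)) \<xi>))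
          = (\<Sum>k<Suc n. info (Suc n - k) ((coin_shift ^^ (j + k)) \<xi>))"
        by (subst sum.lessThan_Suc_shift) simp
      finally show ?case .
    qed
    from this[of 0] have eq: "ln (mass n (X \<xi>)) = - real n * ln 2 - (\<Sum>k<n. info (n - k) ((coin_shift ^^ k) \<xi>))" for n
      by simp
    have "(\<lambda>n. - ln 2 - (\<Sum>k<n. info (n - k) ((coin_shift ^^ k) \<xi>)) / real n) \<longlonglongrightarrow> - ln 2 - (\<integral>\<xi>. info_lim \<xi> \<partial>coin_space)"
      by (intro tendsto_intros elim(4))
    moreover have "\<forall>\<^sub>F n in sequentially. - ln 2 - (\<Sum>k<n. info (n - k) ((coin_shift ^^ k) \<xi>)) / real n = ln (mass n (X \<xi>)) / real n"
      using eventually_gt_at_top[of 0]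
      by eventually_elim (simp add: eq diff_divide_distrib)
    ultimately have "(\<lambda>n. ln (mass n (X \<xi>)) / real n) \<longlonglongrightarrow> - ln 2 - (\<integral>\<xi>. info_lim \<xi> \<partial>coin_space)"
      by (rule Lim_transform_eventually)
    then show ?case by (simp add: cond_entropy_def)
  qed
qed

theorem exact_dim_bernoulli_conv: "exact_dim \<mu> = (ln 2 - cond_entropy) / (- ln l)"
proof (rule exact_dim_eqI[OF prob_space_bernoulli_conv])
  have [measurable]: "{x. (\<lambda>n. ln (mass n x) / real n) \<longlonglongrightarrow> - (ln 2 - cond_entropy)} \<in> sets borel"
    by (rule sets_Collect_tendsto) measurable
  have "AE x in \<mu>. (\<lambda>n. ln (mass n x) / real n) \<longlonglongrightarrow> - (ln 2 - cond_entropy)"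
    unfolding bernoulli_conv_eq[of l]
    using AE_mass_asymptotics by (subst AE_distr_iff) (simp_all flip: bernoulli_conv_eq)
  with M.AE_measure_interval_pos[of radius, OF radius_pos]
  show "has_exact_dim \<mu> ((ln 2 - cond_entropy) / (- ln l))"
    unfolding has_exact_dim_def
  proof eventually_elim
    case (elim x)
    show ?case
    proof (rule tendsto_at_right_of_geometric_scales[where R="2 / (1 - l) + 1"])
      show "measure \<mu> {x - r<..<x + r} \<le> measure \<mu> {x - s<..<x + s}" if "r \<le> s" for r s
        using that by (intro M.finite_measure_mono) auto
      show "measure \<mu> {x - r<..<x + r} \<le> 1" for r by (rule M.prob_le_1)
      show "0 < measure \<mu> {x - r<..<x + r}" if "0 < r" for r
      proof -
        have "\<exists>n. radius n < r"
          by (rule tendsto_ex_less[OF radius_tendsto_0 that])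
        then obtain n where "radius n < r" ..
        have "0 < mass n x" using elim(1) by simp
        also have "\<dots> \<le> measure \<mu> {x - r<..<x + r}"
          using \<open>radius n < r\<close> by (intro M.finite_measure_mono) auto
        finally show ?thesis .
      qed
      show "(\<lambda>n. ln (measure \<mu> {x - (2 / (1 - l) + 1) * l ^ n<..<x + (2 / (1 - l) + 1) * l ^ n}) / real n) \<longlonglongrightarrow> - (ln 2 - cond_entropy)"
        using elim(2) by (simp add: radius_def)
      show "0 < 2 / (1 - l) + 1" using l1 by (simp add: add_pos_pos)
    qed (use l0 l1 in auto)
  qed
qed

end

section \<open>Semicontinuity\<close>

definition coin_weight :: "(real \<Rightarrow> real) \<Rightarrow> real \<Rightarrow> real \<Rightarrow> real" where
  "coin_weight q i x = (if i = 1 then q x else 1 - q x)"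

definition cross_entropy :: "(real \<Rightarrow> real) \<Rightarrow> real \<Rightarrow> real" where
  "cross_entropy q l = - (\<integral>\<xi>. ln (coin_weight q (\<xi> 0) (bsum l \<xi>)) \<partial>coin_space)"

text \<open>Pointwise form of Gibbs' inequality, from \<open>ln t \<le> t - 1\<close>. The
  correction \<open>q - c\<close> vanishes when summed over the two values of the coin, as both
  pairs of weights add up to 1.\<close>

lemma mult_ln_diff_le:
  fixes c q :: real
  assumes "0 \<le> c" "0 < q"
  shows "c * ln q \<le> c * ln c + (q - c)"
proof (cases "c = 0")
  case False
  then have c: "0 < c" using assms by simp
  have "ln (q / c) \<le> q / c - 1" using c assms by (intro ln_le_minus_one) simp
  then have "c * ln (q / c) \<le> c * (q / c - 1)" using c by (intro mult_left_mono) auto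
  then show ?thesis using c assms by (simp add: ln_div algebra_simps)
qed (use assms in simp)

lemma abs_ln_le:
  fixes \<delta> y :: real
  assumes "0 < \<delta>" "\<delta> \<le> y" "y \<le> 1"
  shows "\<bar>ln y\<bar> \<le> - ln \<delta>"
proof -
  have "ln \<delta> \<le> ln y" using assms by simp
  moreover have "ln y \<le> 0" using assms by simp
  ultimately show ?thesis by simp
qed

context bernoulli
begin

lemma measurable_coin_weight_first:
  assumes [measurable]: "q \<in> borel_measurable borel"
  shows "(\<lambda>\<xi>. ln (coin_weight q (\<xi> 0) (X \<xi>))) \<in> borel_measurable coin_space"
proof -
  have [measurable]: "coin_weight q i \<in> borel_measurable borel" for i
    unfolding coin_weight_def[abs_def] by simp
  have "(\<lambda>\<xi>. coin_weight q (\<xi> 0) (X \<xi>)) \<in> borel_measurable coin_space"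
  proof (rule measurable_first_case[of "coin_weight q"])
    show "coin_weight q i = coin_weight q (-1)" if "i \<noteq> 1" for i
      using that by (simp add: coin_weight_def[abs_def])
  qed measurable
  then show ?thesis by measurable
qed

lemma cond_entropy_le_cross_entropy:
  assumes [measurable]: "q \<in> borel_measurable borel"
    and \<delta>: "0 < \<delta>" and q: "\<And>x. \<delta> \<le> q x \<and> q x \<le> 1 - \<delta>"
  shows "cond_entropy \<le> cross_entropy q l"
proof -
  have [measurable]: "coin_weight q i \<in> borel_measurable borel" for i
    unfolding coin_weight_def[abs_def] by simp
  have w: "\<delta> \<le> coin_weight q i x \<and> coin_weight q i x \<le> 1" for i x
    using q[of x] \<delta> by (auto simp: coin_weight_def)
  have intw: "integrable \<mu> (\<lambda>x. cond i x * ln (coin_weight q i x))" for i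
  proof (rule M.integrable_const_bound[where B="- ln \<delta>"])
    show "AE x in \<mu>. norm (cond i x * ln (coin_weight q i x)) \<le> - ln \<delta>"
    proof (rule AE_I2)
      fix x
      have "\<bar>cond i x\<bar> * \<bar>ln (coin_weight q i x)\<bar> \<le> 1 * (- ln \<delta>)"
        using cond_01[of i x] abs_ln_le[OF \<delta>, of "coin_weight q i x"] w by (intro mult_mono) auto
      then show "norm (cond i x * ln (coin_weight q i x)) \<le> - ln \<delta>" by (simp add: abs_mult)
    qed
  qed (rule measurable_mu, measurable)
  have intc: "integrable \<mu> (\<lambda>x. cond i x * ln (cond i x))" for i
  proof (rule M.integrable_const_bound[where B=1])
    show "AE x in \<mu>. norm (cond i x * ln (cond i x)) \<le> 1"
    proof (rule AE_I2)
      fix x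
      have "cond i x * ln (cond i x) \<le> 0"
        using cond_01[of i x] by (cases "cond i x = 0") (auto simp: mult_le_0_iff)
      \<comment> \<open>The same inequality with weight 1 gives the lower bound
        \<open>c * ln c \<ge> c - 1\<close>.\<close>
      moreover have "cond i x * ln 1 \<le> cond i x * ln (cond i x) + (1 - cond i x)"
        using cond_01[of i x] by (intro mult_ln_diff_le) auto
      ultimately show "norm (cond i x * ln (cond i x)) \<le> 1" using cond_01[of i x] by simp
    qed
  qed (rule measurable_mu, measurable)
  have intq: "integrable \<mu> (coin_weight q i)" for i
  proof (rule M.integrable_const_bound[where B=1])
    show "AE x in \<mu>. norm (coin_weight q i x) \<le> 1"
    proof (rule AE_I2)
      fix x show "norm (coin_weight q i x) \<le> 1" using w[of i x] \<delta> by simp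
    qed
  qed (rule measurable_mu, measurable)
  have inti: "integrable \<mu> (cond i)" for i
    using cond_01 by (intro M.integrable_const_bound[where B=1] AE_I2 measurable_mu) auto
  have le: "(\<integral>x. cond i x * ln (coin_weight q i x) \<partial>\<mu>)
    \<le> (\<integral>x. cond i x * ln (cond i x) \<partial>\<mu>) + ((\<integral>x. coin_weight q i x \<partial>\<mu>) - (\<integral>x. cond i x \<partial>\<mu>))" for i
  proof -
    have "(\<integral>x. cond i x * ln (coin_weight q i x) \<partial>\<mu>)
      \<le> (\<integral>x. cond i x * ln (cond i x) + (coin_weight q i x - cond i x) \<partial>\<mu>)"
      using cond_01 w \<delta> intw intc intq inti
      by (intro integral_mono mult_ln_diff_le) (auto intro: less_le_trans)
    then show ?thesis using intc intq inti by simp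
  qed
  have one: "(\<integral>x. f 1 x \<partial>\<mu>) + (\<integral>x. f (-1) x \<partial>\<mu>) = 1"
    if "\<And>x. f 1 x + f (-1) x = 1" "\<And>i. integrable \<mu> (f i)" for f :: "real \<Rightarrow> real \<Rightarrow> real"
    using that(1) M.prob_space by (subst Bochner_Integration.integral_add[symmetric]) (auto intro: that(2))
  have "(\<integral>\<xi>. ln (coin_weight q (\<xi> 0) (X \<xi>)) \<partial>coin_space)
    = (\<integral>x. cond 1 x * ln (coin_weight q 1 x) \<partial>\<mu>) + (\<integral>x. cond (-1) x * ln (coin_weight q (-1) x) \<partial>\<mu>)"
    using intw measurable_coin_weight_first[OF assms(1)]
    by (intro integral_first_coin_sum[of "\<lambda>i x. ln (coin_weight q i x)"]) auto
  also have "\<dots> \<le> (\<integral>x. cond 1 x * ln (cond 1 x) \<partial>\<mu>) + (\<integral>x. cond (-1) x * ln (cond (-1) x) \<partial>\<mu>)"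
    using le[of 1] le[of "-1"] one[of cond, OF _ inti] one[of "coin_weight q", OF _ intq]
    by (simp add: cond_def coin_weight_def)
  also have "\<dots> = (\<integral>\<xi>. ln (cond (\<xi> 0) (X \<xi>)) \<partial>coin_space)"
    using intc by (intro integral_first_coin_sum[of "\<lambda>i x. ln (cond i x)", symmetric]) auto
  finally show ?thesis
    by (simp add: cond_entropy_def cross_entropy_def info_lim_def[abs_def])
qed

text \<open>The true conditional probability is approximated in L1 by a continuous \<open>g\<close>,
  which may touch 0 or 1; mixing with a fair coin gives
  \<open>q = a * g + (1 - a) * (1 / 2)\<close>, and by symmetry the other value of the coin obeys
  the same relation. The mixture costs \<open>- ln a = e / 2\<close>. As
  \<open>ln (1 + t / y) \<le> t / \<delta>\<close>, an L1 error below
  \<open>\<delta> * e / 2\<close> costs at most another \<open>e / 2\<close>.\<close>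

lemma cross_entropy_approx:
  assumes "0 < e"
  shows "\<exists>q \<delta>. continuous_on UNIV q \<and> 0 < \<delta> \<and> (\<forall>x. \<delta> \<le> q x \<and> q x \<le> 1 - \<delta>) \<and> cross_entropy q l \<le> cond_entropy + e"
proof -
  define a where "a = exp (- e / 2)"
  define \<delta> where "\<delta> = (1 - a) / 2"
  have a: "0 < a" "a < 1" using assms by (auto simp: a_def)
  have \<delta>: "0 < \<delta>" using a by (simp add: \<delta>_def)
  then have "0 < \<delta> * e / 2" using assms by simp
  then obtain g where g: "continuous_on UNIV g" "\<And>x. 0 \<le> g x \<and> g x \<le> 1"
    "(\<integral>x. \<bar>cond_prob_1 x - g x\<bar> \<partial>\<mu>) < \<delta> * e / 2"
    using L1_approx_unit_continuous[OF M.finite_measure_axioms M.sets_borel cond_prob_1(1) conjI[OF cond_prob_1(2,3)]]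
    by blast
  have [measurable]: "g \<in> borel_measurable borel" "cond_prob_1 \<in> borel_measurable borel"
    using g(1) by (auto intro: borel_measurable_continuous_onI cond_prob_1(1))
  define q where "q = (\<lambda>x. a * g x + \<delta>)"
  have cont: "continuous_on UNIV q" unfolding q_def by (intro continuous_intros g(1))
  then have [measurable]: "q \<in> borel_measurable borel" by (rule borel_measurable_continuous_onI)
  have q: "\<delta> \<le> q x \<and> q x \<le> 1 - \<delta>" for x
  proof -
    have "0 \<le> a * g x" "a * g x \<le> a * 1" using g(2)[of x] a by (auto intro!: mult_left_mono)
    then show ?thesis by (auto simp: q_def \<delta>_def field_simps)
  qed
  have w: "\<delta> \<le> coin_weight q i x \<and> coin_weight q i x \<le> 1" for i x
    using q[of x] \<delta> by (auto simp: coin_weight_def)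
  let ?d = "\<lambda>x. \<bar>cond_prob_1 x - g x\<bar>"
  have d: "integrable \<mu> ?d"
  proof (rule M.integrable_const_bound[where B=1])
    show "AE x in \<mu>. norm (?d x) \<le> 1"
    proof (rule AE_I2)
      fix x show "norm (?d x) \<le> 1" using g(2)[of x] cond_prob_1(2,3)[of x] by (simp add: abs_le_iff)
    qed
  qed (rule measurable_mu, measurable)
  have dX: "integrable coin_space (\<lambda>\<xi>. ?d (X \<xi>))" "(\<integral>\<xi>. ?d (X \<xi>) \<partial>coin_space) = (\<integral>x. ?d x \<partial>\<mu>)"
  proof -
    show "integrable coin_space (\<lambda>\<xi>. ?d (X \<xi>))"
      using d unfolding bernoulli_conv_eq by (rule integrable_distr[OF measurable_bsum])
    show "(\<integral>\<xi>. ?d (X \<xi>) \<partial>coin_space) = (\<integral>x. ?d x \<partial>\<mu>)"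
      unfolding bernoulli_conv_eq by (rule integral_distr[OF measurable_bsum, symmetric]) measurable
  qed
  have intq: "integrable coin_space (\<lambda>\<xi>. ln (coin_weight q (\<xi> 0) (X \<xi>)))"
  proof (rule shift.integrable_const_bound[where B="- ln \<delta>"])
    show "AE \<xi> in coin_space. norm (ln (coin_weight q (\<xi> 0) (X \<xi>))) \<le> - ln \<delta>"
      using abs_ln_le[OF \<delta>] w by (intro AE_I2) simp
  qed (rule measurable_coin_weight_first, measurable)
  have "(\<integral>\<xi>. info_lim \<xi> - e / 2 - ?d (X \<xi>) / \<delta> \<partial>coin_space) \<le> (\<integral>\<xi>. ln (coin_weight q (\<xi> 0) (X \<xi>)) \<partial>coin_space)"
  proof (rule integral_mono_AE)
    show "AE \<xi> in coin_space. info_lim \<xi> - e / 2 - ?d (X \<xi>) / \<delta> \<le> ln (coin_weight q (\<xi> 0) (X \<xi>))"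
      using AE_cond_at_bounds
    proof eventually_elim
      case (elim \<xi>)
      define c y t where "c = cond (\<xi> 0) (X \<xi>)" and "y = coin_weight q (\<xi> 0) (X \<xi>)" and "t = ?d (X \<xi>)"
      have c: "0 < c" using elim by (simp add: c_def)
      have y: "\<delta> \<le> y" "0 < y" using w \<delta> by (auto simp: y_def intro: less_le_trans)
      have t: "0 \<le> t" by (simp add: t_def)
      have yeq: "y = a * coin_weight g (\<xi> 0) (X \<xi>) + \<delta>"
        by (auto simp: y_def coin_weight_def q_def \<delta>_def field_simps)
      have "c \<le> coin_weight g (\<xi> 0) (X \<xi>) + t"
        by (auto simp: c_def cond_def coin_weight_def t_def)
      then have "a * c \<le> a * (coin_weight g (\<xi> 0) (X \<xi>) + t)" using a by (intro mult_left_mono) auto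
      also have "\<dots> \<le> y + t"
      proof -
        have "a * t \<le> 1 * t" using a t by (intro mult_right_mono) auto
        then show ?thesis using \<delta> by (simp add: yeq distrib_left)
      qed
      finally have "ln (a * c) \<le> ln (y + t)" using a c by (intro ln_mono) auto
      also have "ln (y + t) = ln y + ln (1 + t / y)"
      proof -
        have "y + t = y * (1 + t / y)" using y by (simp add: field_simps)
        moreover have "0 < 1 + t / y" using y t by (simp add: add_pos_nonneg)
        ultimately show ?thesis using y by (simp add: ln_mult)
      qed
      also have "ln (1 + t / y) \<le> t / y" using y t by (intro ln_add_one_self_le_self) simp
      also have "t / y \<le> t / \<delta>" using y t \<delta> by (intro divide_left_mono) auto
      also have "ln (a * c) = ln c - e / 2" using a c by (simp add: ln_mult) (simp add: a_def)
      finally show ?case by (simp add: info_lim_def c_def y_def t_def)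
    qed
  qed (use integrable_info_lim dX intq in auto)
  also have "(\<integral>\<xi>. info_lim \<xi> - e / 2 - ?d (X \<xi>) / \<delta> \<partial>coin_space) = - cond_entropy - e / 2 - (\<integral>x. ?d x \<partial>\<mu>) / \<delta>"
    using integrable_info_lim dX shift.prob_space by (simp add: cond_entropy_def)
  finally have "cross_entropy q l \<le> cond_entropy + e / 2 + (\<integral>x. ?d x \<partial>\<mu>) / \<delta>"
    by (simp add: cross_entropy_def)
  also have "(\<integral>x. ?d x \<partial>\<mu>) / \<delta> \<le> e / 2" using g(3) \<delta> by (simp add: field_simps)
  finally have "cross_entropy q l \<le> cond_entropy + e" by simp
  then show ?thesis using cont \<delta> q by blast
qed

text \<open>All ratios share the space of coin sequences, so only the integrand varies, and it is
  dominated by the constant \<open>- ln \<delta>\<close>.\<close>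

lemma cross_entropy_tendsto:
  assumes cont: "continuous_on UNIV q" and \<delta>: "0 < \<delta>" and q: "\<And>x. \<delta> \<le> q x \<and> q x \<le> 1 - \<delta>"
    and \<eta>: "\<And>n. 0 < \<eta> n \<and> \<eta> n < 1" "\<eta> \<longlonglongrightarrow> l"
  shows "(\<lambda>n. cross_entropy q (\<eta> n)) \<longlonglongrightarrow> cross_entropy q l"
  unfolding cross_entropy_def
proof (intro tendsto_minus integral_dominated_convergence[where w="\<lambda>_. - ln \<delta>"])
  have m: "q \<in> borel_measurable borel" using cont by (rule borel_measurable_continuous_onI)
  have w: "\<delta> \<le> coin_weight q i x \<and> coin_weight q i x \<le> 1" for i x
    using q[of x] \<delta> by (auto simp: coin_weight_def)
  show "(\<lambda>\<xi>. ln (coin_weight q (\<xi> 0) (bsum l \<xi>))) \<in> borel_measurable coin_space"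
    by (rule measurable_coin_weight_first[OF m])
  show "(\<lambda>\<xi>. ln (coin_weight q (\<xi> 0) (bsum (\<eta> n) \<xi>))) \<in> borel_measurable coin_space" for n
    using \<eta>(1)[of n] by (intro bernoulli.measurable_coin_weight_first[OF _ m]) (simp add: bernoulli_def)
  show "AE \<xi> in coin_space. norm (ln (coin_weight q (\<xi> 0) (bsum (\<eta> n) \<xi>))) \<le> - ln \<delta>" for n
    using abs_ln_le[OF \<delta>] w by (intro AE_I2) simp
  show "AE \<xi> in coin_space. (\<lambda>n. ln (coin_weight q (\<xi> 0) (bsum (\<eta> n) \<xi>))) \<longlonglongrightarrow> ln (coin_weight q (\<xi> 0) (bsum l \<xi>))"
    using AE_good
  proof eventually_elim
    case (elim \<xi>)
    have "isCont q (bsum l \<xi>)" using cont by (simp add: continuous_on_eq_continuous_at)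
    then have "(\<lambda>n. q (bsum (\<eta> n) \<xi>)) \<longlonglongrightarrow> q (bsum l \<xi>)"
      by (rule isCont_tendsto_compose[OF _ bsum_tendsto[OF elim l0 l1 \<eta>(2)]])
    then have "(\<lambda>n. coin_weight q (\<xi> 0) (bsum (\<eta> n) \<xi>)) \<longlonglongrightarrow> coin_weight q (\<xi> 0) (bsum l \<xi>)"
      unfolding coin_weight_def by (cases "\<xi> 0 = 1") (auto intro!: tendsto_intros)
    moreover have "coin_weight q (\<xi> 0) (bsum l \<xi>) \<noteq> 0" using w[of "\<xi> 0" "bsum l \<xi>"] \<delta> by linarith
    ultimately show ?case by (intro tendsto_ln)
  qed
qed simp

end

theorem theorem2:
  fixes l \<alpha> :: real and \<eta> :: "nat \<Rightarrow> real"
  assumes "1 / 2 < l" and "l < 1"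
    and "\<alpha> < 1"
    and "\<And>n. 0 < \<eta> n \<and> \<eta> n < 1"
    and "\<eta> \<longlonglongrightarrow> l"
    and "liminf (\<lambda>n. ereal (exact_dim (bernoulli_conv (\<eta> n)))) \<le> ereal \<alpha>"
  shows "exact_dim (bernoulli_conv l) \<le> \<alpha>"
proof (rule field_le_epsilon)
  fix \<epsilon> :: real assume "0 < \<epsilon>"
  interpret bernoulli l using assms(1,2) by unfold_locales auto
  have B: "bernoulli (\<eta> n)" for n using assms(4)[of n] by (simp add: bernoulli_def)
  have lnl: "0 < - ln l" using l0 l1 by simp
  \<comment> \<open>Division by \<open>- ln l\<close> in the dimension formula turns this tolerance
    into \<epsilon>.\<close>
  then have "0 < \<epsilon> * (- ln l)" using \<open>0 < \<epsilon>\<close> by (rule mult_pos_pos[rotated])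
  then obtain q \<delta> where q: "continuous_on UNIV q" "0 < \<delta>" "\<And>x. \<delta> \<le> q x \<and> q x \<le> 1 - \<delta>"
    "cross_entropy q l \<le> cond_entropy + \<epsilon> * (- ln l)"
    using cross_entropy_approx by blast
  \<comment> \<open>A lower bound for the dimension at \<open>\<eta> n\<close>, with one
    \<open>q\<close> for all n; it converges although the dimensions themselves may not.\<close>
  let ?b = "\<lambda>n. (ln 2 - cross_entropy q (\<eta> n)) / (- ln (\<eta> n))"
  have "?b \<longlonglongrightarrow> (ln 2 - cross_entropy q l) / (- ln l)"
    using l0 lnl by (intro tendsto_intros cross_entropy_tendsto[OF q(1-3) assms(4,5)] assms(5)) auto
  then have "liminf (\<lambda>n. ereal (?b n)) = ereal ((ln 2 - cross_entropy q l) / (- ln l))"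
    by (intro lim_imp_Liminf) auto
  moreover have "liminf (\<lambda>n. ereal (?b n)) \<le> liminf (\<lambda>n. ereal (exact_dim (bernoulli_conv (\<eta> n))))"
  proof (intro Liminf_mono always_eventually allI)
    fix n
    have "bernoulli.cond_entropy (\<eta> n) \<le> cross_entropy q (\<eta> n)"
      by (rule bernoulli.cond_entropy_le_cross_entropy[OF B borel_measurable_continuous_onI[OF q(1)] q(2,3)])
    moreover have "0 < - ln (\<eta> n)" using assms(4)[of n] by simp
    ultimately show "ereal (?b n) \<le> ereal (exact_dim (bernoulli_conv (\<eta> n)))"
      unfolding bernoulli.exact_dim_bernoulli_conv[OF B] by (simp only: ereal_less_eq) (intro divide_right_mono; simp)
  qed
  ultimately have "ereal ((ln 2 - cross_entropy q l) / (- ln l)) \<le> ereal \<alpha>"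
    using assms(6) order_trans by metis
  then have "(ln 2 - cross_entropy q l) / (- ln l) \<le> \<alpha>" by simp
  moreover have "(ln 2 - cond_entropy - \<epsilon> * (- ln l)) / (- ln l) \<le> (ln 2 - cross_entropy q l) / (- ln l)"
    using q(4) lnl by (intro divide_right_mono) auto
  moreover have "(ln 2 - cond_entropy - \<epsilon> * (- ln l)) / (- ln l) = exact_dim \<mu> - \<epsilon>"
    unfolding exact_dim_bernoulli_conv using lnl by (simp add: field_simps)
  ultimately show "exact_dim (bernoulli_conv l) \<le> \<alpha> + \<epsilon>" by linarith
qed

end
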